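(* Let $L$ be a $\sigma$-frame and let $f\colon\mathfrak{L}(\overline{\mathbb{R}})\to\mathcal{C}(L)$ be a nonnegative extended real-valued function on $L$ (a nonnegative element of $\overline{\mathsf{F}}(L)=\overline{\mathsf{M}}(\mathcal{C}(L))$). If $f$ is measurable on $L$, then there exist complemented congruences $\theta_{S_1},\theta_{S_2},\ldots\in\mathcal{C}(L)$ such that $$f=\lim_{k\to+\infty}\sum_{i=1}^{k}\tfrac{1}{i}\cdot\chi_{\theta_{S_i}},$$ where the limit is taken in $\overline{\mathsf{F}}(L)$.
   Context: A $\sigma$-frame is a bounded lattice with all countable joins in which $(\bigvee_{a\in A}a)\wedge b=\bigvee_{a\in A}(a\wedge b)$ for every countable $A$ and every $b$. A $\sigma$-frame homomorphism preserves finite meets (including the top) and countable joins (including the bottom). A congruence on a $\sigma$-frame $L$ is an equivalence relation on $L$ closed under binary meets and countable joins (as a subset of $L\times L$). $\mathcal{C}(L)$, the set of all congruences on $L$ ordered by inclusion, is a frame (hence a $\sigma$-frame). For $a\in L$, $\nabla_a=\{(x,y)\in L\times L\mid x\vee a=y\vee a\}$, and $\nabla[L]=\{\nabla_a\mid a\in L\}\subseteq\mathcal{C}(L)$. $\mathfrak{L}(\overline{\mathbb{R}})$ is the frame, equivalently $\sigma$-frame, generated by symbols $(p,\text{---})$, $(\text{---},q)$ with $p,q\in\mathbb{Q}$, subject to: (1) $(p,\text{---})\wedge(\text{---},q)=0$ if $p\ge q$; (2) $(p,\text{---})\vee(\text{---},q)=1$ if $p<q$; (3) $(p,\text{---})=\bigvee_{r>p}(r,\text{---})$;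 (4) $(\text{---},q)=\bigvee_{s<q}(\text{---},s)$. $\mathfrak{L}(\mathbb{R})$ is defined likewise with the further relations $\bigvee_{p}(p,\text{---})=1$ and $\bigvee_{q}(\text{---},q)=1$. For a $\sigma$-frame $N$, $\overline{\mathsf{M}}(N)$ is the set of $\sigma$-frame homomorphisms $\mathfrak{L}(\overline{\mathbb{R}})\to N$, ordered by $f\le g$ iff $f(p,\text{---})\le g(p,\text{---})$ for all $p\in\mathbb{Q}$ (equivalently $g(\text{---},q)\le f(\text{---},q)$ for all $q$). $\mathsf{M}(N)$ is the set of $\sigma$-frame homomorphisms $\mathfrak{L}(\mathbb{R})\to N$, regarded as the subset of those $f\in\overline{\mathsf{M}}(N)$ with $\bigvee_p f(p,\text{---})=1=\bigvee_q f(\text{---},q)$. Put $\overline{\mathsf{F}}(L)=\overline{\mathsf{M}}(\mathcal{C}(L))$. An $f\in\overline{\mathsf{F}}(L)$ is measurable on $L$ if $f(p,\text{---}),f(\text{---},q)\in\nabla[L]$ for all $p,q\in\mathbb{Q}$. The constant function $\mathbf{0}$: $\mathbf{0}(p,\text{---})=1$ if $p<0$ and $0$ otherwise; $\mathbf{0}(\text{---},q)=1$ if $q>0$ and $0$ otherwise. $f$ is nonnegative if $f\ge\mathbf{0}$. For complemented $a\in N$ with complement $a^c$, $\chi_a\in\mathsf{M}(N)$ is given by $\chi_a(p,\text{---})=1$ if $p<0$, $a$ if $0\le p<1$, $0$ if $p\ge1$; $\chi_a(\text{---},q)=0$ if $q\le0$, $a^c$ if $0<q\le1$, $1$ if $q>1$.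 For $f,g\in\mathsf{M}(N)$ and rational $\lambda>0$: $(\lambda\cdot f)(p,\text{---})=f(p/\lambda,\text{---})$, $(\lambda\cdot f)(\text{---},q)=f(\text{---},q/\lambda)$; $(f+g)(p,\text{---})=\bigvee_{t\in\mathbb{Q}}(f(t,\text{---})\wedge g(p-t,\text{---}))$, $(f+g)(\text{---},q)=\bigvee_{t\in\mathbb{Q}}(f(\text{---},t)\wedge g(\text{---},q-t))$. Limits: for a sequence $(f_k)_{k\in\mathbb{N}}$ in $\overline{\mathsf{M}}(N)$, with $\sup$, $\inf$ denoting joins and meets in the poset $\overline{\mathsf{M}}(N)$ (which may fail to exist), $\liminf f_k=\sup_{n\ge1}\inf_{k\ge n}f_k$ and $\limsup f_k=\inf_{n\ge1}\sup_{k\ge n}f_k$. If both exist and are equal, the limit exists and $\lim_k f_k$ is their common value. *)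

theory Defs
  imports Complex_Main "HOL-Library.Countable_Set"
begin

section \<open>Sigma-frames\<close>

text \<open>Only joins of countable sets are constrained; \<^term>\<open>Sup A\<close> is unspecified for
  uncountable \<^term>\<open>A\<close>.\<close>

class sigma_frame = bounded_lattice + Sup +
  assumes sf_Sup_upper: "countable A \<Longrightarrow> x \<in> A \<Longrightarrow> x \<le> Sup A"
    and sf_Sup_least: "countable A \<Longrightarrow> (\<And>x. x \<in> A \<Longrightarrow> x \<le> z) \<Longrightarrow> Sup A \<le> z"
    and sf_Sup_inf: "countable A \<Longrightarrow> inf (Sup A) b = Sup ((\<lambda>a. inf a b) ` A)"
begin

lemma sf_Sup_eqI:
  assumes "countable A" "\<And>x. x \<in> A \<Longrightarrow> x \<le> s" "\<And>z. (\<And>x. x \<in> A \<Longrightarrow> x \<le> z) \<Longrightarrow> s \<le> z"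
  shows "Sup A = s"
  by (rule order.antisym) (use assms sf_Sup_least sf_Sup_upper in blast)+

lemma sf_Sup_empty [simp]: "Sup {} = bot"
  by (rule sf_Sup_eqI) auto

lemma sf_Sup_pair: "Sup {x, y} = sup x y"
  by (rule sf_Sup_eqI) auto

lemma sf_inf_sup: "inf (sup x y) b = sup (inf x b) (inf y b)"
  using sf_Sup_inf[of "{x, y}" b] by (simp add: sf_Sup_pair)

subclass distrib_lattice
  proof
  have "inf x (sup y z) = sup (inf x y) (inf x z)" for x y z
    using sf_inf_sup[of y z x] inf.commute by metis
  then show "sup x (inf y z) = inf (sup x y) (sup x z)" for x y z
    by (rule distrib_imp1)
qed

lemma sf_inf_Sup: "countable A \<Longrightarrow> inf b (Sup A) = Sup (inf b ` A)"
  using sf_Sup_inf[of A b] by (simp add: inf.commute)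

lemma sf_Sup_upper2: "countable A \<Longrightarrow> x \<in> A \<Longrightarrow> y \<le> x \<Longrightarrow> y \<le> Sup A"
  using sf_Sup_upper order_trans by blast

end

definition sigma_frame_hom :: "('a::sigma_frame \<Rightarrow> 'b::sigma_frame) \<Rightarrow> bool" where
  "sigma_frame_hom h \<longleftrightarrow>
     h top = top \<and> (\<forall>x y. h (inf x y) = inf (h x) (h y)) \<and>
     (\<forall>A. countable A \<longrightarrow> h (Sup A) = Sup (h ` A))"

definition is_complement :: "'a::bounded_lattice \<Rightarrow> 'a \<Rightarrow> bool" where
  "is_complement a c \<longleftrightarrow> inf a c = bot \<and> sup a c = top"

definition is_complemented :: "'a::bounded_lattice \<Rightarrow> bool" where
  "is_complemented a \<longleftrightarrow> (\<exists>c. is_complement a c)"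

definition the_complement :: "'a::bounded_lattice \<Rightarrow> 'a" where
  "the_complement a = (THE c. is_complement a c)"

lemma is_complement_unique:
  fixes a :: "'a::sigma_frame"
  assumes "is_complement a c" "is_complement a d"
  shows "c = d"
proof -
  have "c \<le> d" if "is_complement a c" "is_complement a d" for c d :: 'a
  proof -
    have "c = inf (sup a d) c" using that by (simp add: is_complement_def)
    also have "\<dots> = inf d c"
      using that by (metis sf_inf_sup is_complement_def sup_bot_left)
    finally show ?thesis by (metis inf.cobounded1)
  qed
  then show ?thesis using assms by (simp add: order.antisym)
qed

lemma the_complement_works:
  fixes a :: "'a::sigma_frame"
  shows "is_complemented a \<Longrightarrow> is_complement a (the_complement a)"
  unfolding the_complement_def is_complemented_def
  by (rule theI') (use is_complement_unique in blast)


section \<open>Congruences\<close>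

definition is_congruence :: "('a::sigma_frame \<times> 'a) set \<Rightarrow> bool" where
  "is_congruence R \<longleftrightarrow> equiv UNIV R \<and>
     (\<forall>x y x' y'. (x, y) \<in> R \<longrightarrow> (x', y') \<in> R \<longrightarrow> (inf x x', inf y y') \<in> R) \<and>
     (\<forall>A. countable A \<longrightarrow> A \<subseteq> R \<longrightarrow> (Sup (fst ` A), Sup (snd ` A)) \<in> R)"

lemma is_congruenceD:
  assumes "is_congruence R"
  shows "(x, x) \<in> R" "(x, y) \<in> R \<Longrightarrow> (y, x) \<in> R" "(x, y) \<in> R \<Longrightarrow> (y, z) \<in> R \<Longrightarrow> (x, z) \<in> R"
    "(x, y) \<in> R \<Longrightarrow> (x', y') \<in> R \<Longrightarrow> (inf x x', inf y y') \<in> R"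
    "countable A \<Longrightarrow> A \<subseteq> R \<Longrightarrow> (Sup (fst ` A), Sup (snd ` A)) \<in> R"
proof -
  have R: "equiv UNIV R" using assms by (simp add: is_congruence_def)
  show "(x, x) \<in> R" using R by (auto simp: equiv_def refl_on_def)
  show "(x, y) \<in> R \<Longrightarrow> (y, x) \<in> R" using R by (auto simp: equiv_def dest: symD)
  show "(x, y) \<in> R \<Longrightarrow> (y, z) \<in> R \<Longrightarrow> (x, z) \<in> R"
    using R unfolding equiv_def by (blast dest: transD)
  show "(x, y) \<in> R \<Longrightarrow> (x', y') \<in> R \<Longrightarrow> (inf x x', inf y y') \<in> R"
    "countable A \<Longrightarrow> A \<subseteq> R \<Longrightarrow> (Sup (fst ` A), Sup (snd ` A)) \<in> R"
    using assms by (simp_all add: is_congruence_def)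
qed

lemma is_congruence_sup:
  assumes "is_congruence R" "(x, y) \<in> R" "(x', y') \<in> R"
  shows "(sup x x', sup y y') \<in> R"
  using is_congruenceD(5)[OF assms(1), of "{(x, y), (x', y')}"] assms(2,3)
  by (simp add: sf_Sup_pair)

lemma is_congruenceI:
  assumes "\<And>x. (x, x) \<in> R" "\<And>x y. (x, y) \<in> R \<Longrightarrow> (y, x) \<in> R"
    "\<And>x y z. (x, y) \<in> R \<Longrightarrow> (y, z) \<in> R \<Longrightarrow> (x, z) \<in> R"
    "\<And>x y x' y'. (x, y) \<in> R \<Longrightarrow> (x', y') \<in> R \<Longrightarrow> (inf x x', inf y y') \<in> R"
    "\<And>A. countable A \<Longrightarrow> A \<subseteq> R \<Longrightarrow> (Sup (fst ` A), Sup (snd ` A)) \<in> R"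
  shows "is_congruence R"
  unfolding is_congruence_def
proof (intro conjI allI impI)
  show "equiv UNIV R"
    by (rule equivI) (simp, use assms(1) in \<open>simp add: refl_on_def\<close>,
      rule symI, erule assms(2), rule transI, erule (1) assms(3))
qed (use assms(4,5) in blast)+

lemma is_congruence_UNIV: "is_congruence UNIV"
  by (rule is_congruenceI) auto

lemma is_congruence_Inter:
  assumes "\<And>R. R \<in> \<R> \<Longrightarrow> is_congruence R"
  shows "is_congruence (\<Inter>\<R>)"
proof (rule is_congruenceI)
  fix A assume A: "countable A" "A \<subseteq> \<Inter>\<R>"
  show "(Sup (fst ` A), Sup (snd ` A)) \<in> \<Inter>\<R>"
  proof
    fix R assume "R \<in> \<R>"
    then show "(Sup (fst ` A), Sup (snd ` A)) \<in> R"
      using is_congruenceD(5)[OF assms, of R A] A by blast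
  qed
next
  fix x y assume "(x, y) \<in> \<Inter>\<R>"
  then show "(y, x) \<in> \<Inter>\<R>" by (auto intro: is_congruenceD(2)[OF assms])
next
  fix x y z assume xyz: "(x, y) \<in> \<Inter>\<R>" "(y, z) \<in> \<Inter>\<R>"
  show "(x, z) \<in> \<Inter>\<R>"
  proof
    fix R assume "R \<in> \<R>"
    then show "(x, z) \<in> R" using is_congruenceD(3)[OF assms, of R x y z] xyz by simp
  qed
qed (auto intro: is_congruenceD(1,4)[OF assms])

typedef (overloaded) 'a congruence = "{R :: ('a::sigma_frame \<times> 'a) set. is_congruence R}"
  morphisms pairs Congruence
  using is_congruence_UNIV by blast

setup_lifting type_definition_congruence

lemma is_congruence_pairs: "is_congruence (pairs R)"
  using pairs by blast

instantiation congruence :: (sigma_frame) complete_lattice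
begin

lift_definition less_eq_congruence :: "'a congruence \<Rightarrow> 'a congruence \<Rightarrow> bool" is "(\<subseteq>)" .

lift_definition less_congruence :: "'a congruence \<Rightarrow> 'a congruence \<Rightarrow> bool" is "(\<subset>)" .

lift_definition Inf_congruence :: "'a congruence set \<Rightarrow> 'a congruence" is "\<lambda>\<R>. \<Inter>\<R>"
  by (rule is_congruence_Inter) blast

lift_definition inf_congruence :: "'a congruence \<Rightarrow> 'a congruence \<Rightarrow> 'a congruence" is "(\<inter>)"
  subgoal for R S using is_congruence_Inter[of "{R, S}"] by auto
  done

lift_definition top_congruence :: "'a congruence" is UNIV
  by (rule is_congruence_UNIV)

definition "Sup_congruence \<R> = Inf {S :: 'a congruence. \<forall>R\<in>\<R>. R \<le> S}"

definition "sup_congruence R S = Inf {T :: 'a congruence. R \<le> T \<and> S \<le> T}"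

definition "bot_congruence = (Inf UNIV :: 'a congruence)"

instance
proof
  have Inf1: "Inf \<R> \<le> R" if "R \<in> \<R>" for R :: "'a congruence" and \<R>
    using that by transfer blast
  have Inf2: "S \<le> Inf \<R>" if "\<And>R. R \<in> \<R> \<Longrightarrow> S \<le> R" for S :: "'a congruence" and \<R>
    using that unfolding less_eq_congruence.rep_eq Inf_congruence.rep_eq by blast
  fix x y z :: "'a congruence" and A :: "'a congruence set"
  show "x < y \<longleftrightarrow> x \<le> y \<and> \<not> y \<le> x" by transfer auto
  show "x \<le> x" by transfer auto
  show "x \<le> y \<Longrightarrow> y \<le> z \<Longrightarrow> x \<le> z" by transfer auto
  show "x \<le> y \<Longrightarrow> y \<le> x \<Longrightarrow> x = y" by transfer auto
  show "inf x y \<le> x" "inf x y \<le> y" by (transfer, auto)+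
  show "x \<le> y \<Longrightarrow> x \<le> z \<Longrightarrow> x \<le> inf y z" by transfer auto
  show "x \<le> sup x y" "y \<le> sup x y"
    unfolding sup_congruence_def by (rule Inf2, auto)+
  show "y \<le> x \<Longrightarrow> z \<le> x \<Longrightarrow> sup y z \<le> x"
    unfolding sup_congruence_def by (rule Inf1) auto
  show "x \<in> A \<Longrightarrow> Inf A \<le> x" by (rule Inf1)
  show "(\<And>x. x \<in> A \<Longrightarrow> z \<le> x) \<Longrightarrow> z \<le> Inf A" by (rule Inf2)
  show "x \<in> A \<Longrightarrow> x \<le> Sup A" unfolding Sup_congruence_def by (rule Inf2) auto
  show "(\<And>x. x \<in> A \<Longrightarrow> x \<le> z) \<Longrightarrow> Sup A \<le> z"
    unfolding Sup_congruence_def by (rule Inf1) auto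
  show "Inf {} = (top :: 'a congruence)" by transfer simp
  show "Sup {} = (bot :: 'a congruence)"
    unfolding Sup_congruence_def bot_congruence_def by simp
qed

end

text \<open>For \<open>c \<le> d\<close> this retracts the lattice onto the interval between \<open>c\<close> and \<open>d\<close>.\<close>

definition interval_map :: "'a::lattice \<Rightarrow> 'a \<Rightarrow> 'a \<Rightarrow> 'a" where
  "interval_map c d x = sup (inf x d) c"

text \<open>The Heyting implication of the lattice of congruences, used to prove the frame law.\<close>

definition congruence_imp :: "('a::sigma_frame \<times> 'a) set \<Rightarrow> ('a \<times> 'a) set \<Rightarrow> ('a \<times> 'a) set" where
  "congruence_imp P Q = {(x, y). \<forall>c d. c \<le> d \<longrightarrow> (c, d) \<in> P \<longrightarrow> (interval_map c d x, interval_map c d y) \<in> Q}"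

lemma interval_map_Sup:
  fixes A :: "'a::sigma_frame set"
  assumes "countable A" "A \<noteq> {}"
  shows "interval_map c d (Sup A) = Sup (interval_map c d ` A)"
proof (rule sf_Sup_eqI[symmetric])
  show "x \<le> interval_map c d (Sup A)" if x: "x \<in> interval_map c d ` A" for x
  proof -
    obtain a where "a \<in> A" "x = interval_map c d a" using x by blast
    then show ?thesis
      using sf_Sup_upper[OF assms(1)] unfolding interval_map_def by (metis inf_mono order_refl sup_mono)
  qed
  show "interval_map c d (Sup A) \<le> z" if z: "\<And>x. x \<in> interval_map c d ` A \<Longrightarrow> x \<le> z" for z
  proof -
    have z': "inf a d \<le> z" "c \<le> z" if "a \<in> A" for a
      using z[of "interval_map c d a"] that by (auto simp: interval_map_def)
    have "inf (Sup A) d \<le> z"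
      unfolding sf_Sup_inf[OF assms(1)]
      by (rule sf_Sup_least) (use assms(1) z' in auto)
    then show ?thesis using z' assms(2) by (auto simp: interval_map_def)
  qed
qed (use assms in auto)

lemma is_congruence_imp:
  assumes "is_congruence Q"
  shows "is_congruence (congruence_imp P Q)"
proof (rule is_congruenceI)
  note Q = is_congruenceD[OF assms]
  have I: "(x, y) \<in> congruence_imp P Q"
    if "\<And>c d. c \<le> d \<Longrightarrow> (c, d) \<in> P \<Longrightarrow> (interval_map c d x, interval_map c d y) \<in> Q" for x y
    using that by (simp add: congruence_imp_def)
  have E: "(interval_map c d x, interval_map c d y) \<in> Q"
    if "(x, y) \<in> congruence_imp P Q" "c \<le> d" "(c, d) \<in> P" for c d x y
    using that by (simp add: congruence_imp_def)
  show "(x, x) \<in> congruence_imp P Q" for x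
    by (rule I) (rule Q(1))
  show "(y, x) \<in> congruence_imp P Q" if "(x, y) \<in> congruence_imp P Q" for x y
    by (rule I, rule Q(2), rule E[OF that])
  show "(x, z) \<in> congruence_imp P Q"
    if "(x, y) \<in> congruence_imp P Q" "(y, z) \<in> congruence_imp P Q" for x y z
    by (rule I, rule Q(3)[OF E[OF that(1)] E[OF that(2)]])
  have "interval_map c d (inf x y) = inf (interval_map c d x) (interval_map c d y)" for c d x y :: 'a
    unfolding interval_map_def sup_inf_distrib2[symmetric]
    by (simp add: inf.left_commute inf.commute)
  then show "(inf x x', inf y y') \<in> congruence_imp P Q"
    if "(x, y) \<in> congruence_imp P Q" "(x', y') \<in> congruence_imp P Q" for x y x' y'
    by (intro I) (simp add: Q(4) E[OF that(1)] E[OF that(2)])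
  show "(Sup (fst ` A), Sup (snd ` A)) \<in> congruence_imp P Q"
    if A: "countable A" "A \<subseteq> congruence_imp P Q" for A
  proof (cases "A = {}")
    case True
    then show ?thesis by (intro I) (simp add: Q(1))
  next
    case False
    have "(interval_map c d (Sup (fst ` A)), interval_map c d (Sup (snd ` A))) \<in> Q"
      if cd: "c \<le> d" "(c, d) \<in> P" for c d
    proof -
      have "(Sup (fst ` map_prod (interval_map c d) (interval_map c d) ` A),
             Sup (snd ` map_prod (interval_map c d) (interval_map c d) ` A)) \<in> Q"
        by (rule Q(5)) (use A cd in \<open>auto simp: congruence_imp_def\<close>)
      then show ?thesis using A(1) False by (simp add: interval_map_Sup image_image)
    qed
    then show ?thesis by (rule I)
  qed
qed

theorem congruence_frame:
  fixes \<phi> :: "'a::sigma_frame congruence"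
  shows "inf (Sup \<Theta>) \<phi> = Sup ((\<lambda>\<theta>. inf \<theta> \<phi>) ` \<Theta>)"
proof (rule order.antisym)
  define \<psi> where "\<psi> = Sup ((\<lambda>\<theta>. inf \<theta> \<phi>) ` \<Theta>)"
  define \<chi> where "\<chi> = Congruence (congruence_imp (pairs \<phi>) (pairs \<psi>))"
  have \<chi>: "pairs \<chi> = congruence_imp (pairs \<phi>) (pairs \<psi>)"
    unfolding \<chi>_def by (simp add: Congruence_inverse is_congruence_imp is_congruence_pairs)
  note cg = is_congruenceD[OF is_congruence_pairs] is_congruence_sup[OF is_congruence_pairs]
  have "\<theta> \<le> \<chi>" if \<theta>: "\<theta> \<in> \<Theta>" for \<theta>
    unfolding less_eq_congruence.rep_eq \<chi>
  proof clarify
    fix x y assume xy: "(x, y) \<in> pairs \<theta>"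
    have "(interval_map c d x, interval_map c d y) \<in> pairs \<psi>" if cd: "c \<le> d" "(c, d) \<in> pairs \<phi>" for c d
    proof -
      have "(interval_map c d x, interval_map c d y) \<in> pairs \<theta>"
        unfolding interval_map_def by (intro cg(4,6) xy cg(1))
      moreover have collapse: "(interval_map c d z, c) \<in> pairs \<phi>" for z
      proof -
        have "(d, c) \<in> pairs \<phi>" using cd(2) by (rule cg(2))
        then have "(sup (inf z d) c, sup (inf z c) c) \<in> pairs \<phi>" by (intro cg(4,6) cg(1))
        then show ?thesis by (simp add: interval_map_def sup_absorb2)
      qed
      have "(interval_map c d x, interval_map c d y) \<in> pairs \<phi>"
        by (rule cg(3)[OF collapse cg(2)[OF collapse]])
      ultimately have "(interval_map c d x, interval_map c d y) \<in> pairs (inf \<theta> \<phi>)"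
        by (simp add: inf_congruence.rep_eq)
      moreover have "inf \<theta> \<phi> \<le> \<psi>" unfolding \<psi>_def using \<theta> by (intro Sup_upper imageI)
      ultimately show ?thesis unfolding less_eq_congruence.rep_eq by blast
    qed
    then show "(x, y) \<in> congruence_imp (pairs \<phi>) (pairs \<psi>)"
      unfolding congruence_imp_def by blast
  qed
  then have le: "pairs (Sup \<Theta>) \<subseteq> pairs \<chi>"
    by (simp add: Sup_least less_eq_congruence.rep_eq[symmetric])
  have "(x, y) \<in> pairs \<psi>" if xy: "(x, y) \<in> pairs (Sup \<Theta>)" "(x, y) \<in> pairs \<phi>" for x y
  proof -
    have *: "(inf x y, sup x y) \<in> pairs \<rho>" if "(x, y) \<in> pairs \<rho>" for \<rho>
    proof -
      have "(inf x y, inf y y) \<in> pairs \<rho>" by (intro cg(4) that cg(1))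
      moreover have "(sup y y, sup x y) \<in> pairs \<rho>" by (intro cg(6) cg(2)[OF that] cg(1))
      ultimately show ?thesis by (simp only: inf_idem sup_idem) (rule cg(3))
    qed
    have "(inf x y, sup x y) \<in> pairs \<chi>" using le *[OF xy(1)] by blast
    then have "(interval_map (inf x y) (sup x y) (inf x y), interval_map (inf x y) (sup x y) (sup x y)) \<in> pairs \<psi>"
      using *[OF xy(2)] unfolding \<chi> congruence_imp_def by (auto simp: le_supI1)
    moreover have "interval_map (inf x y) (sup x y) (inf x y) = inf x y"
      "interval_map (inf x y) (sup x y) (sup x y) = sup x y"
      unfolding interval_map_def by (auto intro!: order.antisym simp: le_supI1 le_infI1)
    ultimately have m: "(inf x y, sup x y) \<in> pairs \<psi>" by simp
    have "(inf (inf x y) x, inf (sup x y) x) \<in> pairs \<psi>"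
      "(inf (inf x y) y, inf (sup x y) y) \<in> pairs \<psi>"
      by (intro cg(4) m cg(1))+
    moreover have "inf (inf x y) x = inf x y" "inf (inf x y) y = inf x y"
      "inf (sup x y) x = x" "inf (sup x y) y = y"
      by (auto intro!: order.antisym simp: le_infI1 le_supI1)
    ultimately show ?thesis by (metis cg(2,3))
  qed
  then show "inf (Sup \<Theta>) \<phi> \<le> Sup ((\<lambda>\<theta>. inf \<theta> \<phi>) ` \<Theta>)"
    unfolding \<psi>_def[symmetric] less_eq_congruence.rep_eq inf_congruence.rep_eq by auto
next
  show "Sup ((\<lambda>\<theta>. inf \<theta> \<phi>) ` \<Theta>) \<le> inf (Sup \<Theta>) \<phi>"
    by (intro SUP_least inf_mono Sup_upper order_refl)
qed

instance congruence :: (sigma_frame) sigma_frame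
  by standard (auto intro: Sup_upper Sup_least simp: congruence_frame)

lift_definition nabla :: "'a::sigma_frame \<Rightarrow> 'a congruence" is
  "\<lambda>a. {(x, y). sup x a = sup y a}"
proof (rule is_congruenceI)
  fix a :: 'a and A assume A: "countable A" "A \<subseteq> {(x, y). sup x a = sup y a}"
  have *: "Sup (f ` A) \<le> sup (Sup (g ` A)) a"
    if fg: "\<And>z. z \<in> A \<Longrightarrow> sup (f z) a = sup (g z) a" for f g
  proof (rule sf_Sup_least)
    fix x assume "x \<in> f ` A"
    then obtain z where z: "z \<in> A" "x = f z" by blast
    then have "x \<le> sup (g z) a" using fg by (metis sup.cobounded1)
    also have "\<dots> \<le> sup (Sup (g ` A)) a"
      using A(1) z by (intro sup_mono sf_Sup_upper) auto
    finally show "x \<le> sup (Sup (g ` A)) a" .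
  qed (use A in auto)
  have "sup (Sup (fst ` A)) a = sup (Sup (snd ` A)) a"
    using *[of fst snd] *[of snd fst] A(2) by (intro order.antisym) (auto simp: subset_iff)
  then show "(Sup (fst ` A), Sup (snd ` A)) \<in> {(x, y). sup x a = sup y a}" by simp
qed (auto simp: sup_inf_distrib2)


section \<open>Sigma-frames presented by generators and relations\<close>

datatype 'g sf_term =
    Gen 'g | Top | Bot | Meet "'g sf_term" "'g sf_term" | Join "nat \<Rightarrow> 'g sf_term"

definition Join2 :: "'g sf_term \<Rightarrow> 'g sf_term \<Rightarrow> 'g sf_term" where
  "Join2 s t = Join (\<lambda>n. if n = 0 then s else t)"

inductive sf_le :: "('g sf_term \<times> 'g sf_term) set \<Rightarrow> 'g sf_term \<Rightarrow> 'g sf_term \<Rightarrow> bool"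
  for R where
  refl: "sf_le R s s"
| trans: "sf_le R s t \<Longrightarrow> sf_le R t u \<Longrightarrow> sf_le R s u"
| Top: "sf_le R s Top"
| Bot: "sf_le R Bot s"
| Meet1: "sf_le R (Meet s t) s"
| Meet2: "sf_le R (Meet s t) t"
| Meet_greatest: "sf_le R s t \<Longrightarrow> sf_le R s u \<Longrightarrow> sf_le R s (Meet t u)"
| Join_upper: "sf_le R (s n) (Join s)"
| Join_least: "(\<And>n. sf_le R (s n) t) \<Longrightarrow> sf_le R (Join s) t"
| distrib: "sf_le R (Meet (Join s) t) (Join (\<lambda>n. Meet (s n) t))"
| rel1: "(s, t) \<in> R \<Longrightarrow> sf_le R s t"
| rel2: "(s, t) \<in> R \<Longrightarrow> sf_le R t s"

primrec sf_eval :: "('g \<Rightarrow> 'n::sigma_frame) \<Rightarrow> 'g sf_term \<Rightarrow> 'n" where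
  "sf_eval v (Gen g) = v g"
| "sf_eval v Top = top"
| "sf_eval v Bot = bot"
| "sf_eval v (Meet s t) = inf (sf_eval v s) (sf_eval v t)"
| "sf_eval v (Join s) = (SUP n. sf_eval v (s n))"

lemma sf_eval_Join2: "sf_eval v (Join2 s t) = sup (sf_eval v s) (sf_eval v t)"
proof -
  have "(\<lambda>n::nat. sf_eval v (if n = 0 then s else t)) ` UNIV = {sf_eval v s, sf_eval v t}"
    by (auto simp: image_iff intro: exI[of _ 1])
  then show ?thesis by (simp add: Join2_def sf_Sup_pair)
qed

lemma sf_le_eval:
  assumes "sf_le R s t" and "\<And>s t. (s, t) \<in> R \<Longrightarrow> sf_eval v s = sf_eval v t"
  shows "sf_eval v s \<le> sf_eval v t"
  using assms(1)
proof induction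
  case (distrib s t)
  then show ?case by (simp add: sf_Sup_inf image_image)
next
  case (Join_least s t)
  then show ?case by (auto intro!: sf_Sup_least)
next
  case (Join_upper s n)
  then show ?case by (auto intro!: sf_Sup_upper)
qed (auto simp: le_infI1 le_infI2 assms(2) intro: order_trans)


section \<open>The frame of extended reals\<close>

text \<open>\<^term>\<open>Gt_Ray p\<close> is the generator \<open>(p,---)\<close> and \<^term>\<open>Lt_Ray q\<close> is \<open>(---,q)\<close>.
  Since joins of terms are indexed by natural numbers, the last two relations are
  imposed for every enumeration of the (countable, infinite) set of joinands.\<close>

datatype ereal_gen = Gt_Ray rat | Lt_Ray rat

inductive_set ereal_rels :: "(ereal_gen sf_term \<times> ereal_gen sf_term) set" where
  "q \<le> p \<Longrightarrow> (Meet (Gen (Gt_Ray p)) (Gen (Lt_Ray q)), Bot) \<in> ereal_rels"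
| "p < q \<Longrightarrow> (Join2 (Gen (Gt_Ray p)) (Gen (Lt_Ray q)), Top) \<in> ereal_rels"
| "range s = (\<lambda>r. Gen (Gt_Ray r)) ` {r. p < r} \<Longrightarrow> (Gen (Gt_Ray p), Join s) \<in> ereal_rels"
| "range s = (\<lambda>r. Gen (Lt_Ray r)) ` {r. r < q} \<Longrightarrow> (Gen (Lt_Ray q), Join s) \<in> ereal_rels"

definition ereal_eq :: "ereal_gen sf_term \<Rightarrow> ereal_gen sf_term \<Rightarrow> bool" where
  "ereal_eq s t \<longleftrightarrow> sf_le ereal_rels s t \<and> sf_le ereal_rels t s"

quotient_type ereal_frame = "ereal_gen sf_term" / ereal_eq
  by (rule equivpI; unfold reflp_def symp_def transp_def ereal_eq_def)
    (blast intro: sf_le.refl sf_le.trans)+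

lift_definition gt_ray :: "rat \<Rightarrow> ereal_frame" is "\<lambda>p. Gen (Gt_Ray p)" .

lift_definition lt_ray :: "rat \<Rightarrow> ereal_frame" is "\<lambda>q. Gen (Lt_Ray q)" .

lift_definition ereal_Join :: "(nat \<Rightarrow> ereal_frame) \<Rightarrow> ereal_frame" is Join
  unfolding ereal_eq_def rel_fun_def
  by (meson sf_le.Join_least sf_le.Join_upper sf_le.trans)

instantiation ereal_frame :: sigma_frame
begin

lift_definition less_eq_ereal_frame :: "ereal_frame \<Rightarrow> ereal_frame \<Rightarrow> bool" is "sf_le ereal_rels"
  unfolding ereal_eq_def by (meson sf_le.trans)

definition "less_ereal_frame (x :: ereal_frame) y \<longleftrightarrow> x \<le> y \<and> \<not> y \<le> x"

lift_definition top_ereal_frame :: ereal_frame is Top .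

lift_definition bot_ereal_frame :: ereal_frame is Bot .

lift_definition inf_ereal_frame :: "ereal_frame \<Rightarrow> ereal_frame \<Rightarrow> ereal_frame" is Meet
  unfolding ereal_eq_def by (meson sf_le.Meet1 sf_le.Meet2 sf_le.Meet_greatest sf_le.trans)

definition "Sup_ereal_frame A =
  (if A = {} then bot else ereal_Join (from_nat_into (A :: ereal_frame set)))"

definition "sup_ereal_frame (x :: ereal_frame) y = Sup {x, y}"

instance
proof
  fix x y z :: ereal_frame and A :: "ereal_frame set"
  show "x < y \<longleftrightarrow> x \<le> y \<and> \<not> y \<le> x" by (rule less_ereal_frame_def)
  show "x \<le> x" by transfer (rule sf_le.refl)
  show trans: "x \<le> y \<Longrightarrow> y \<le> z \<Longrightarrow> x \<le> z" for x y z :: ereal_frame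
    by transfer (rule sf_le.trans)
  show "x \<le> y \<Longrightarrow> y \<le> x \<Longrightarrow> x = y" by transfer (simp add: ereal_eq_def)
  show "inf x y \<le> x" "inf x y \<le> y" by (transfer, rule sf_le.Meet1 sf_le.Meet2)+
  show "x \<le> y \<Longrightarrow> x \<le> z \<Longrightarrow> x \<le> inf y z" by transfer (rule sf_le.Meet_greatest)
  show bot: "bot \<le> x" for x :: ereal_frame by transfer (rule sf_le.Bot)
  show "x \<le> top" by transfer (rule sf_le.Top)
  have Join1: "s n \<le> ereal_Join s" for s n by transfer (rule sf_le.Join_upper)
  have Join2: "(\<And>n. s n \<le> t) \<Longrightarrow> ereal_Join s \<le> t" for s t
    by transfer (rule sf_le.Join_least)
  have Join3: "inf (ereal_Join s) t \<le> ereal_Join (\<lambda>n. inf (s n) t)" for s t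
    by transfer (rule sf_le.distrib)
  show Sup1: "x \<le> Sup A" if A: "countable A" "x \<in> A" for x :: ereal_frame and A
  proof -
    obtain n where "x = from_nat_into A n" using A from_nat_into_surj by metis
    then show ?thesis using A(2) by (auto simp: Sup_ereal_frame_def intro: Join1)
  qed
  show Sup2: "Sup A \<le> z" if A: "countable A" "\<And>x. x \<in> A \<Longrightarrow> x \<le> z" for z :: ereal_frame and A
    using A by (auto simp: Sup_ereal_frame_def bot intro!: Join2 from_nat_into)
  show "x \<le> sup x y" "y \<le> sup x y" unfolding sup_ereal_frame_def by (auto intro: Sup1)
  show "y \<le> x \<Longrightarrow> z \<le> x \<Longrightarrow> sup y z \<le> x" unfolding sup_ereal_frame_def by (auto intro: Sup2)
  show "inf (Sup A) z = Sup ((\<lambda>a. inf a z) ` A)" if A: "countable A"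
  proof -
    have anti: "a \<le> b \<Longrightarrow> b \<le> a \<Longrightarrow> a = b" for a b :: ereal_frame
      by transfer (simp add: ereal_eq_def)
    have inf1: "inf a b \<le> a" and inf2: "inf a b \<le> b" for a b :: ereal_frame
      by (transfer, rule sf_le.Meet1 sf_le.Meet2)+
    have inf3: "c \<le> a \<Longrightarrow> c \<le> b \<Longrightarrow> c \<le> inf a b" for a b c :: ereal_frame
      by transfer (rule sf_le.Meet_greatest)
    have "inf (Sup A) z \<le> Sup ((\<lambda>a. inf a z) ` A)"
    proof (cases "A = {}")
      case True
      then show ?thesis by (simp add: Sup_ereal_frame_def inf1)
    next
      case False
      then have "inf (Sup A) z \<le> ereal_Join (\<lambda>n. inf (from_nat_into A n) z)"
        by (simp add: Sup_ereal_frame_def Join3)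
      moreover have "\<dots> \<le> Sup ((\<lambda>a. inf a z) ` A)"
        by (rule Join2, rule Sup1) (use A False in \<open>auto intro: from_nat_into\<close>)
      ultimately show ?thesis using trans by blast
    qed
    moreover have "Sup ((\<lambda>a. inf a z) ` A) \<le> inf (Sup A) z"
    proof (rule Sup2)
      fix x assume "x \<in> (\<lambda>a. inf a z) ` A"
      then obtain a where a: "a \<in> A" "x = inf a z" by blast
      show "x \<le> inf (Sup A) z"
        unfolding a(2) by (intro inf3 inf2 trans[OF inf1 Sup1[OF A a(1)]])
    qed (use A in simp)
    ultimately show ?thesis by (rule anti)
  qed
qed

end

lemma abs_ereal_frame_eqI:
  assumes "(s, t) \<in> ereal_rels"
  shows "abs_ereal_frame s = abs_ereal_frame t"
  using assms by (simp add: ereal_frame.abs_eq_iff ereal_eq_def sf_le.rel1 sf_le.rel2)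

lemma abs_rep_ereal_frame: "abs_ereal_frame (rep_ereal_frame x) = x"
  by (rule Quotient3_abs_rep[OF Quotient3_ereal_frame])

lemma abs_Join: "abs_ereal_frame (Join s) = (SUP n. abs_ereal_frame (s n))"
proof (rule sf_Sup_eqI[symmetric])
  show "x \<le> abs_ereal_frame (Join s)" if "x \<in> range (\<lambda>n. abs_ereal_frame (s n))" for x
    using that by (auto simp: less_eq_ereal_frame.abs_eq intro: sf_le.Join_upper)
  show "abs_ereal_frame (Join s) \<le> z"
    if z: "\<And>x. x \<in> range (\<lambda>n. abs_ereal_frame (s n)) \<Longrightarrow> x \<le> z" for z
  proof -
    have "abs_ereal_frame (s n) \<le> abs_ereal_frame (rep_ereal_frame z)" for n
      using z[of "abs_ereal_frame (s n)"] by (simp add: abs_rep_ereal_frame)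
    then have "abs_ereal_frame (Join s) \<le> abs_ereal_frame (rep_ereal_frame z)"
      by (simp add: less_eq_ereal_frame.abs_eq sf_le.Join_least)
    then show ?thesis by (simp add: abs_rep_ereal_frame)
  qed
qed auto

lemma abs_Join2: "abs_ereal_frame (Join2 s t) = sup (abs_ereal_frame s) (abs_ereal_frame t)"
proof -
  have "(\<lambda>n::nat. abs_ereal_frame (if n = 0 then s else t)) ` UNIV
      = {abs_ereal_frame s, abs_ereal_frame t}"
    by (auto simp: image_iff intro: exI[of _ 1])
  then show ?thesis by (simp add: Join2_def abs_Join sf_Sup_pair)
qed

lemma ereal_frame_rels:
  "q \<le> p \<Longrightarrow> inf (gt_ray p) (lt_ray q) = bot"
  "p < q \<Longrightarrow> sup (gt_ray p) (lt_ray q) = top"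
  "gt_ray p = (SUP r\<in>{r. p < r}. gt_ray r)"
  "lt_ray q = (SUP r\<in>{r. r < q}. lt_ray r)"
proof -
  show "inf (gt_ray p) (lt_ray q) = bot" if "q \<le> p"
    using abs_ereal_frame_eqI[OF ereal_rels.intros(1)[OF that]]
    by (simp add: gt_ray_def lt_ray_def inf_ereal_frame.abs_eq bot_ereal_frame_def)
  show "sup (gt_ray p) (lt_ray q) = top" if "p < q"
    using abs_ereal_frame_eqI[OF ereal_rels.intros(2)[OF that]]
    by (simp add: gt_ray_def lt_ray_def abs_Join2 top_ereal_frame_def)
  define s where "s = from_nat_into ((\<lambda>r. Gen (Gt_Ray r)) ` {r. p < r})"
  have s: "range s = (\<lambda>r. Gen (Gt_Ray r)) ` {r. p < r}"
    unfolding s_def by (rule range_from_nat_into) (auto simp: gt_ex)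
  have "range (\<lambda>n. abs_ereal_frame (s n)) = gt_ray ` {r. p < r}"
    using arg_cong[OF s, of "image abs_ereal_frame"]
    by (simp add: image_image gt_ray_def[abs_def])
  then show "gt_ray p = (SUP r\<in>{r. p < r}. gt_ray r)"
    using abs_ereal_frame_eqI[OF ereal_rels.intros(3)[OF s]]
    by (simp add: abs_Join gt_ray_def)
  define t where "t = from_nat_into ((\<lambda>r. Gen (Lt_Ray r)) ` {r. r < q})"
  have t: "range t = (\<lambda>r. Gen (Lt_Ray r)) ` {r. r < q}"
    unfolding t_def by (rule range_from_nat_into) (auto simp: lt_ex)
  have "range (\<lambda>n. abs_ereal_frame (t n)) = lt_ray ` {r. r < q}"
    using arg_cong[OF t, of "image abs_ereal_frame"]
    by (simp add: image_image lt_ray_def[abs_def])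
  then show "lt_ray q = (SUP r\<in>{r. r < q}. lt_ray r)"
    using abs_ereal_frame_eqI[OF ereal_rels.intros(4)[OF t]]
    by (simp add: abs_Join lt_ray_def)
qed

definition satisfies_ereal_rels :: "(rat \<Rightarrow> 'n::sigma_frame) \<Rightarrow> (rat \<Rightarrow> 'n) \<Rightarrow> bool" where
  "satisfies_ereal_rels a b \<longleftrightarrow>
     (\<forall>p q. q \<le> p \<longrightarrow> inf (a p) (b q) = bot) \<and>
     (\<forall>p q. p < q \<longrightarrow> sup (a p) (b q) = top) \<and>
     (\<forall>p. a p = (SUP r\<in>{r. p < r}. a r)) \<and>
     (\<forall>q. b q = (SUP s\<in>{s. s < q}. b s))"

text \<open>The map sending \<^term>\<open>gt_ray p\<close> to \<^term>\<open>a p\<close> and \<^term>\<open>lt_ray q\<close> to \<^term>\<open>b q\<close>; it is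
  only meaningful if \<^term>\<open>satisfies_ereal_rels a b\<close> holds, in which case it is the
  homomorphism given by the universal property.\<close>

definition ereal_hom :: "(rat \<Rightarrow> 'n::sigma_frame) \<Rightarrow> (rat \<Rightarrow> 'n) \<Rightarrow> ereal_frame \<Rightarrow> 'n" where
  "ereal_hom a b x = sf_eval (case_ereal_gen a b) (rep_ereal_frame x)"

lemma sf_eval_ereal_rels:
  assumes "satisfies_ereal_rels a b" "(s, t) \<in> ereal_rels"
  shows "sf_eval (case_ereal_gen a b) s = sf_eval (case_ereal_gen a b) t"
proof -
  have ab: "q \<le> p \<Longrightarrow> inf (a p) (b q) = bot" "p < q \<Longrightarrow> sup (a p) (b q) = top" for p q
    using assms(1) unfolding satisfies_ereal_rels_def by blast+
  have a: "Sup (a ` {r. p < r}) = a p" for p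
    using assms(1) unfolding satisfies_ereal_rels_def by metis
  have b: "Sup (b ` {r. r < q}) = b q" for q
    using assms(1) unfolding satisfies_ereal_rels_def by metis
  let ?e = "sf_eval (case_ereal_gen a b)"
  have *: "?e (Join s) = Sup (?e ` range s)" for s :: "nat \<Rightarrow> ereal_gen sf_term"
    by (simp add: image_image)
  show ?thesis using assms(2)
  proof cases
    case (3 u p)
    show ?thesis unfolding 3(1,2) * 3(3) by (simp add: image_image a)
  next
    case (4 u q)
    show ?thesis unfolding 4(1,2) * 4(3) by (simp add: image_image b)
  qed (simp_all add: sf_eval_Join2 ab)
qed

lemma ereal_hom_abs:
  assumes "satisfies_ereal_rels a b"
  shows "ereal_hom a b (abs_ereal_frame t) = sf_eval (case_ereal_gen a b) t"
proof -
  have "ereal_eq (rep_ereal_frame (abs_ereal_frame t)) t"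
    by (simp add: abs_rep_ereal_frame flip: ereal_frame.abs_eq_iff)
  then show ?thesis
    unfolding ereal_hom_def ereal_eq_def
    by (intro order.antisym) (auto intro!: sf_le_eval intro: sf_eval_ereal_rels[OF assms])
qed

theorem ereal_hom_universal:
  assumes "satisfies_ereal_rels a b"
  shows "sigma_frame_hom (ereal_hom a b)" "ereal_hom a b (gt_ray p) = a p"
    "ereal_hom a b (lt_ray q) = b q"
proof -
  note h = ereal_hom_abs[OF assms]
  show "ereal_hom a b (gt_ray p) = a p" "ereal_hom a b (lt_ray q) = b q"
    by (simp_all add: gt_ray_def lt_ray_def h)
  have "ereal_hom a b (Sup A) = Sup (ereal_hom a b ` A)" if "countable A" for A
  proof (cases "A = {}")
    case True
    then show ?thesis by (simp add: bot_ereal_frame_def h)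
  next
    case False
    define s where "s n = rep_ereal_frame (from_nat_into A n)" for n
    have abs_s: "abs_ereal_frame (s n) = from_nat_into A n" for n
      by (simp add: s_def abs_rep_ereal_frame)
    have A: "A = range (\<lambda>n. abs_ereal_frame (s n))"
      using range_from_nat_into[OF False that] by (simp add: abs_s)
    have "ereal_hom a b (Sup A) = ereal_hom a b (abs_ereal_frame (Join s))"
      by (simp add: A abs_Join)
    also have "\<dots> = (SUP n. ereal_hom a b (abs_ereal_frame (s n)))" by (simp add: h)
    also have "\<dots> = Sup (ereal_hom a b ` A)" by (subst A) (simp add: image_image)
    finally show ?thesis .
  qed
  moreover have "ereal_hom a b (inf x y) = inf (ereal_hom a b x) (ereal_hom a b y)" for x y
    by (induct x rule: ereal_frame.abs_induct, induct y rule: ereal_frame.abs_induct)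
      (simp add: inf_ereal_frame.abs_eq h)
  ultimately show "sigma_frame_hom (ereal_hom a b)"
    by (simp add: sigma_frame_hom_def top_ereal_frame_def h)
qed

lemma sigma_frame_homD:
  assumes "sigma_frame_hom h"
  shows "h top = top" "h bot = bot" "h (inf x y) = inf (h x) (h y)" "h (sup x y) = sup (h x) (h y)"
    "countable A \<Longrightarrow> h (Sup A) = Sup (h ` A)"
proof -
  show "h top = top" "h (inf x y) = inf (h x) (h y)"
    and S: "countable A \<Longrightarrow> h (Sup A) = Sup (h ` A)" for A
    using assms by (auto simp: sigma_frame_hom_def)
  show "h bot = bot" using S[of "{}"] by simp
  show "h (sup x y) = sup (h x) (h y)" using S[of "{x, y}"] by (simp add: sf_Sup_pair)
qed

lemma ereal_hom_unique:
  assumes "sigma_frame_hom f" "sigma_frame_hom g"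
    "\<And>p. f (gt_ray p) = g (gt_ray p)" "\<And>q. f (lt_ray q) = g (lt_ray q)"
  shows "f = g"
proof
  note fg = sigma_frame_homD[OF assms(1)] sigma_frame_homD[OF assms(2)]
  have "f (abs_ereal_frame t) = g (abs_ereal_frame t)" for t
  proof (induction t)
    case (Gen g')
    then show ?case using assms(3,4) by (cases g') (simp_all add: gt_ray_def lt_ray_def)
  next
    case (Join s)
    then show ?case by (simp add: abs_Join fg image_image)
  qed (simp_all add: fg flip: top_ereal_frame_def bot_ereal_frame_def inf_ereal_frame.abs_eq)
  then show "f x = g x" for x
    by (induct x rule: ereal_frame.abs_induct)
qed


section \<open>Extended real-valued functions\<close>

definition ereal_functions :: "(ereal_frame \<Rightarrow> 'n::sigma_frame) set" where
  "ereal_functions = {f. sigma_frame_hom f}"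

text \<open>The homomorphisms on the frame of reals, identified with those on \<^typ>\<open>ereal_frame\<close>
  that respect the two additional relations.\<close>

definition real_functions :: "(ereal_frame \<Rightarrow> 'n::sigma_frame) set" where
  "real_functions = {f \<in> ereal_functions. (SUP p. f (gt_ray p)) = top \<and> (SUP q. f (lt_ray q)) = top}"

definition ereal_fun_le :: "(ereal_frame \<Rightarrow> 'n::sigma_frame) \<Rightarrow> (ereal_frame \<Rightarrow> 'n) \<Rightarrow> bool" where
  "ereal_fun_le f g \<longleftrightarrow> (\<forall>p. f (gt_ray p) \<le> g (gt_ray p))"

definition zero_fun :: "ereal_frame \<Rightarrow> 'n::sigma_frame" where
  "zero_fun = ereal_hom (\<lambda>p. if p < 0 then top else bot) (\<lambda>q. if q > 0 then top else bot)"

definition nonneg_fun :: "(ereal_frame \<Rightarrow> 'n::sigma_frame) \<Rightarrow> bool" where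
  "nonneg_fun f \<longleftrightarrow> ereal_fun_le zero_fun f"

text \<open>Only meaningful for complemented \<open>a\<close>, when \<^term>\<open>the_complement a\<close> is the unique
  complement.\<close>

definition chi_fun :: "'n::sigma_frame \<Rightarrow> ereal_frame \<Rightarrow> 'n" where
  "chi_fun a = ereal_hom
     (\<lambda>p. if p < 0 then top else if p < 1 then a else bot)
     (\<lambda>q. if q \<le> 0 then bot else if q \<le> 1 then the_complement a else top)"

definition scale_fun :: "rat \<Rightarrow> (ereal_frame \<Rightarrow> 'n::sigma_frame) \<Rightarrow> ereal_frame \<Rightarrow> 'n" where
  "scale_fun c f = ereal_hom (\<lambda>p. f (gt_ray (p / c))) (\<lambda>q. f (lt_ray (q / c)))"

text \<open>A homomorphism when both arguments lie in \<^const>\<open>real_functions\<close>; see \<open>add_fun_real\<close> below.\<close>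

definition add_fun ::
    "(ereal_frame \<Rightarrow> 'n::sigma_frame) \<Rightarrow> (ereal_frame \<Rightarrow> 'n) \<Rightarrow> ereal_frame \<Rightarrow> 'n" where
  "add_fun f g = ereal_hom
     (\<lambda>p. SUP t. inf (f (gt_ray t)) (g (gt_ray (p - t))))
     (\<lambda>q. SUP t. inf (f (lt_ray t)) (g (lt_ray (q - t))))"

text \<open>\<^term>\<open>sum_fun h k\<close> is \<open>h 1 + \<dots> + h k\<close>; the summand \<open>h 0\<close> is not used.\<close>

primrec sum_fun :: "(nat \<Rightarrow> ereal_frame \<Rightarrow> 'n::sigma_frame) \<Rightarrow> nat \<Rightarrow> ereal_frame \<Rightarrow> 'n" where
  "sum_fun h 0 = zero_fun"
| "sum_fun h (Suc k) = add_fun (sum_fun h k) (h (Suc k))"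

definition measurable_fun :: "(ereal_frame \<Rightarrow> 'a::sigma_frame congruence) \<Rightarrow> bool" where
  "measurable_fun f \<longleftrightarrow> (\<forall>p. f (gt_ray p) \<in> range nabla) \<and> (\<forall>q. f (lt_ray q) \<in> range nabla)"


section \<open>Limits in the poset of extended real-valued functions\<close>

definition is_sup_fun ::
    "(ereal_frame \<Rightarrow> 'n::sigma_frame) set \<Rightarrow> (ereal_frame \<Rightarrow> 'n) \<Rightarrow> bool" where
  "is_sup_fun A s \<longleftrightarrow> s \<in> ereal_functions \<and> (\<forall>f\<in>A. ereal_fun_le f s) \<and>
     (\<forall>u\<in>ereal_functions. (\<forall>f\<in>A. ereal_fun_le f u) \<longrightarrow> ereal_fun_le s u)"

definition is_inf_fun ::
    "(ereal_frame \<Rightarrow> 'n::sigma_frame) set \<Rightarrow> (ereal_frame \<Rightarrow> 'n) \<Rightarrow> bool" where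
  "is_inf_fun A i \<longleftrightarrow> i \<in> ereal_functions \<and> (\<forall>f\<in>A. ereal_fun_le i f) \<and>
     (\<forall>u\<in>ereal_functions. (\<forall>f\<in>A. ereal_fun_le u f) \<longrightarrow> ereal_fun_le u i)"

text \<open>These suprema and infima need not exist, so limits are rendered as relations: \<open>I n\<close> below is the
  infimum (respectively \<open>S n\<close> the supremum) of the tail starting at \<open>n\<close>.\<close>

definition is_liminf_fun ::
    "(nat \<Rightarrow> ereal_frame \<Rightarrow> 'n::sigma_frame) \<Rightarrow> (ereal_frame \<Rightarrow> 'n) \<Rightarrow> bool" where
  "is_liminf_fun F l \<longleftrightarrow> (\<exists>I. (\<forall>n\<ge>1. is_inf_fun (F ` {n..}) (I n)) \<and> is_sup_fun (I ` {1..}) l)"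

definition is_limsup_fun ::
    "(nat \<Rightarrow> ereal_frame \<Rightarrow> 'n::sigma_frame) \<Rightarrow> (ereal_frame \<Rightarrow> 'n) \<Rightarrow> bool" where
  "is_limsup_fun F l \<longleftrightarrow> (\<exists>S. (\<forall>n\<ge>1. is_sup_fun (F ` {n..}) (S n)) \<and> is_inf_fun (S ` {1..}) l)"

definition is_lim_fun ::
    "(nat \<Rightarrow> ereal_frame \<Rightarrow> 'n::sigma_frame) \<Rightarrow> (ereal_frame \<Rightarrow> 'n) \<Rightarrow> bool" where
  "is_lim_fun F l \<longleftrightarrow> (\<forall>k\<ge>1. F k \<in> ereal_functions) \<and> is_liminf_fun F l \<and> is_limsup_fun F l"


section \<open>Well-definedness of the operations\<close>

lemma ereal_fun_le_antisym:
  assumes "f \<in> ereal_functions" "g \<in> ereal_functions" "ereal_fun_le f g" "ereal_fun_le g f"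
  shows "f = g"
proof (rule ereal_hom_unique)
  show f: "sigma_frame_hom f" and g: "sigma_frame_hom g"
    using assms by (simp_all add: ereal_functions_def)
  show eq: "f (gt_ray p) = g (gt_ray p)" for p
    using assms(3,4) by (simp add: ereal_fun_le_def order.antisym)
  have "f (lt_ray q) \<le> g (lt_ray q)"
    if f: "sigma_frame_hom f" and g: "sigma_frame_hom g"
      and eq: "\<And>p. f (gt_ray p) = g (gt_ray p)"
    for q and f g :: "ereal_frame \<Rightarrow> 'a"
  proof -
    have "f (lt_ray s) \<le> g (lt_ray q)" if "s < q" for s
    proof -
      have "sup (g (gt_ray s)) (g (lt_ray q)) = top"
        using sigma_frame_homD(1,4)[OF g] ereal_frame_rels(2)[OF that] by metis
      moreover have "inf (f (gt_ray s)) (f (lt_ray s)) = bot"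
        using sigma_frame_homD(2,3)[OF f] ereal_frame_rels(1)[OF order_refl] by metis
      ultimately have "f (lt_ray s) = inf (g (lt_ray q)) (f (lt_ray s))"
        using sf_inf_sup[of "g (gt_ray s)" "g (lt_ray q)" "f (lt_ray s)"] by (simp add: eq)
      then show ?thesis by (metis inf.cobounded1)
    qed
    moreover have "f (lt_ray q) = Sup (f ` lt_ray ` {s. s < q})"
      by (subst ereal_frame_rels(4)) (simp add: sigma_frame_homD(5)[OF f])
    ultimately show ?thesis by (auto intro!: sf_Sup_least)
  qed
  from this[OF f g eq] this[OF g f eq[symmetric]] show "f (lt_ray q) = g (lt_ray q)" for q
    by (rule order.antisym)
qed

lemma satisfies_ereal_relsI:
  assumes "\<And>p q. q \<le> p \<Longrightarrow> inf (a p) (b q) = bot" "\<And>p q. p < q \<Longrightarrow> sup (a p) (b q) = top"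
    "\<And>p. a p = (SUP r\<in>{r. p < r}. a r)" "\<And>q. b q = (SUP s\<in>{s. s < q}. b s)"
  shows "satisfies_ereal_rels a b"
  unfolding satisfies_ereal_rels_def using assms by blast

lemma ereal_functionsD:
  assumes "f \<in> ereal_functions"
  shows "q \<le> p \<Longrightarrow> inf (f (gt_ray p)) (f (lt_ray q)) = bot"
    "p < q \<Longrightarrow> sup (f (gt_ray p)) (f (lt_ray q)) = top"
    "f (gt_ray p) = (SUP r\<in>{r. p < r}. f (gt_ray r))"
    "f (lt_ray q) = (SUP s\<in>{s. s < q}. f (lt_ray s))"
    "p \<le> p' \<Longrightarrow> f (gt_ray p') \<le> f (gt_ray p)"
    "q \<le> q' \<Longrightarrow> f (lt_ray q) \<le> f (lt_ray q')"
proof -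
  have f: "sigma_frame_hom f" using assms by (simp add: ereal_functions_def)
  note h = sigma_frame_homD[OF f]
  show "q \<le> p \<Longrightarrow> inf (f (gt_ray p)) (f (lt_ray q)) = bot"
    using h(2,3) ereal_frame_rels(1) by metis
  show "p < q \<Longrightarrow> sup (f (gt_ray p)) (f (lt_ray q)) = top"
    using h(1,4) ereal_frame_rels(2) by metis
  show 3: "f (gt_ray p) = (SUP r\<in>{r. p < r}. f (gt_ray r))" for p
    by (subst ereal_frame_rels(3)) (simp add: h(5) image_image)
  show 4: "f (lt_ray q) = (SUP s\<in>{s. s < q}. f (lt_ray s))" for q
    by (subst ereal_frame_rels(4)) (simp add: h(5) image_image)
  show "f (gt_ray p') \<le> f (gt_ray p)" if "p \<le> p'"
  proof (cases "p = p'")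
    case False
    then show ?thesis using that by (subst 3[of p]) (auto intro!: sf_Sup_upper)
  qed simp
  show "f (lt_ray q) \<le> f (lt_ray q')" if "q \<le> q'"
  proof (cases "q = q'")
    case False
    then show ?thesis using that by (subst 4[of q']) (auto intro!: sf_Sup_upper)
  qed simp
qed

lemma ereal_hom_in:
  assumes "satisfies_ereal_rels a b"
  shows "ereal_hom a b \<in> ereal_functions"
  using ereal_hom_universal(1)[OF assms] by (simp add: ereal_functions_def)

lemma ereal_hom_real:
  assumes "satisfies_ereal_rels a b" "(SUP p. a p) = top" "(SUP q. b q) = top"
  shows "ereal_hom a b \<in> real_functions"
  using ereal_hom_in[OF assms(1)] assms(2,3)
  by (simp add: real_functions_def ereal_hom_universal[OF assms(1)])

lemma step_fun_rels:
  fixes a :: "rat \<Rightarrow> 'n::sigma_frame"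
  shows "(\<And>p r. p < r \<Longrightarrow> a r \<le> a p) \<Longrightarrow> (\<And>p. \<exists>r>p. a r = a p) \<Longrightarrow> a p = (SUP r\<in>{r. p < r}. a r)"
    "(\<And>p r. r < p \<Longrightarrow> a r \<le> a p) \<Longrightarrow> (\<And>p. \<exists>r<p. a r = a p) \<Longrightarrow> a p = (SUP r\<in>{r. r < p}. a r)"
proof -
  assume *: "\<And>p r. p < r \<Longrightarrow> a r \<le> a p" "\<And>p. \<exists>r>p. a r = a p"
  obtain r where r: "r > p" "a r = a p" using *(2) by blast
  then show "a p = (SUP r\<in>{r. p < r}. a r)"
  proof (intro sf_Sup_eqI[symmetric])
    show "a p \<le> z" if "\<And>x. x \<in> a ` {r. p < r} \<Longrightarrow> x \<le> z" for z
      using that[of "a p"] r by (metis (mono_tags) image_eqI mem_Collect_eq)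
  qed (use *(1) in auto)
next
  assume *: "\<And>p r. r < p \<Longrightarrow> a r \<le> a p" "\<And>p. \<exists>r<p. a r = a p"
  obtain r where r: "r < p" "a r = a p" using *(2) by blast
  then show "a p = (SUP r\<in>{r. r < p}. a r)"
  proof (intro sf_Sup_eqI[symmetric])
    show "a p \<le> z" if "\<And>x. x \<in> a ` {r. r < p} \<Longrightarrow> x \<le> z" for z
      using that[of "a p"] r by (metis (mono_tags) image_eqI mem_Collect_eq)
  qed (use *(1) in auto)
qed

lemma sf_Sup_topI: "countable A \<Longrightarrow> top \<in> A \<Longrightarrow> Sup A = (top :: 'a::sigma_frame)"
  using sf_Sup_upper top_le by blast

lemma chi_fun_rels:
  fixes a :: "'n::sigma_frame"
  assumes "is_complement a c"
  shows "satisfies_ereal_rels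
    (\<lambda>p. if p < 0 then top else if p < 1 then a else bot)
    (\<lambda>q. if q \<le> 0 then bot else if q \<le> 1 then c else top)"
proof (rule satisfies_ereal_relsI)
  show "(if p < 0 then top else if p < 1 then a else bot) =
    (SUP r\<in>{r. p < r}. if r < 0 then top else if r < 1 then a else bot)" for p :: rat
  proof (rule step_fun_rels(1))
    fix p :: rat
    show "\<exists>r>p. (if r < 0 then top else if r < 1 then a else bot)
        = (if p < 0 then top else if p < 1 then a else bot)"
      by (rule exI[of _ "if p < 0 then p / 2 else if p < 1 then (p + 1) / 2 else p + 1"])
        (auto simp: field_simps)
  qed auto
  show "(if q \<le> 0 then bot else if q \<le> 1 then c else top) =
    (SUP r\<in>{r. r < q}. if r \<le> 0 then bot else if r \<le> 1 then c else top)" for q :: rat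
  proof (rule step_fun_rels(2))
    fix q :: rat
    show "\<exists>r<q. (if r \<le> 0 then bot else if r \<le> 1 then c else top)
        = (if q \<le> 0 then bot else if q \<le> 1 then c else top)"
      by (rule exI[of _ "if q \<le> 0 then q - 1 else if q \<le> 1 then q / 2 else (q + 1) / 2"])
        (auto simp: field_simps)
  qed auto
qed (use assms in \<open>auto simp: is_complement_def\<close>)

lemma chi_fun_real:
  fixes a :: "'n::sigma_frame"
  assumes "is_complemented a"
  shows "chi_fun a \<in> real_functions"
  unfolding chi_fun_def
  by (rule ereal_hom_real[OF chi_fun_rels[OF the_complement_works[OF assms]]];
      rule sf_Sup_topI; auto simp: image_iff intro: exI[of _ "-1"] exI[of _ "2"])

lemma zero_fun_rels:
  "satisfies_ereal_rels (\<lambda>p. if p < 0 then top else bot :: 'n::sigma_frame)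
     (\<lambda>q. if q > 0 then top else bot)"
proof (rule satisfies_ereal_relsI)
  show "(if p < 0 then top else bot :: 'n) = (SUP r\<in>{r. p < r}. if r < 0 then top else bot)"
    for p :: rat
  proof (rule step_fun_rels(1))
    fix p :: rat
    show "\<exists>r>p. (if r < 0 then top else bot :: 'n) = (if p < 0 then top else bot)"
      by (rule exI[of _ "if p < 0 then p / 2 else p + 1"]) auto
  qed auto
  show "(if q > 0 then top else bot :: 'n) = (SUP r\<in>{r. r < q}. if r > 0 then top else bot)"
    for q :: rat
  proof (rule step_fun_rels(2))
    fix q :: rat
    show "\<exists>r<q. (if r > 0 then top else bot :: 'n) = (if q > 0 then top else bot)"
      by (rule exI[of _ "if q > 0 then q / 2 else q - 1"]) auto
  qed auto
qed auto

lemma zero_fun_real: "zero_fun \<in> real_functions"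
  unfolding zero_fun_def
  by (rule ereal_hom_real[OF zero_fun_rels];
      rule sf_Sup_topI; auto simp: image_iff intro: exI[of _ "-1"] exI[of _ "1"])

lemma scale_fun_rels:
  assumes "c > 0" "f \<in> ereal_functions"
  shows "satisfies_ereal_rels (\<lambda>p. f (gt_ray (p / c))) (\<lambda>q. f (lt_ray (q / c)))"
proof (rule satisfies_ereal_relsI)
  note f = ereal_functionsD[OF assms(2)]
  show "q \<le> p \<Longrightarrow> inf (f (gt_ray (p / c))) (f (lt_ray (q / c))) = bot" for p q
    using assms(1) by (intro f(1)) (simp add: divide_right_mono)
  show "p < q \<Longrightarrow> sup (f (gt_ray (p / c))) (f (lt_ray (q / c))) = top" for p q
    using assms(1) by (intro f(2)) (simp add: divide_strict_right_mono)
  have "{r. p / c < r} = (\<lambda>r. r / c) ` {r. p < r}" for p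
    using assms(1) by (auto simp: image_iff field_simps intro!: exI[of _ "_ * c"])
  then show "f (gt_ray (p / c)) = (SUP r\<in>{r. p < r}. f (gt_ray (r / c)))" for p
    using f(3)[of "p / c"] by (simp add: image_image)
  have "{r. r < q / c} = (\<lambda>r. r / c) ` {r. r < q}" for q
    using assms(1) by (auto simp: image_iff field_simps intro!: exI[of _ "_ * c"])
  then show "f (lt_ray (q / c)) = (SUP r\<in>{r. r < q}. f (lt_ray (r / c)))" for q
    using f(4)[of "q / c"] by (simp add: image_image)
qed

lemma scale_fun_real:
  assumes "c > 0" "f \<in> real_functions"
  shows "scale_fun c f \<in> real_functions"
proof -
  have f: "f \<in> ereal_functions" "(SUP p. f (gt_ray p)) = top" "(SUP q. f (lt_ray q)) = top"
    using assms(2) by (auto simp: real_functions_def)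
  have "range (\<lambda>p. h (p / c)) = range h" for h :: "rat \<Rightarrow> 'a"
  proof -
    have "h p \<in> range (\<lambda>p. h (p / c))" for p
      using assms(1) by (intro range_eqI[of _ _ "p * c"]) simp
    then show ?thesis by auto
  qed
  from this[of "\<lambda>p. f (gt_ray p)"] this[of "\<lambda>p. f (lt_ray p)"] show ?thesis
    unfolding scale_fun_def
    by (intro ereal_hom_real scale_fun_rels assms(1)) (simp_all add: f)
qed

lemma sf_Sup_inf_Sup_le:
  fixes A B :: "'n::sigma_frame set"
  assumes "countable A" "countable B" "\<And>a b. a \<in> A \<Longrightarrow> b \<in> B \<Longrightarrow> inf a b \<le> z"
  shows "inf (Sup A) (Sup B) \<le> z"
proof -
  have "inf a (Sup B) \<le> z" if "a \<in> A" for a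
    unfolding sf_inf_Sup[OF assms(2)]
    by (rule sf_Sup_least) (use assms(2,3) that in auto)
  then show ?thesis
    unfolding sf_Sup_inf[OF assms(1)] by (intro sf_Sup_least) (use assms(1) in auto)
qed

lemma real_functions_cover:
  assumes "f \<in> real_functions" "e > 0"
  shows "(SUP t. inf (f (gt_ray t)) (f (lt_ray (t + e)))) = top"
proof -
  have f': "f \<in> ereal_functions" "(SUP p. f (gt_ray p)) = top" "(SUP q. f (lt_ray q)) = top"
    using assms(1) by (auto simp: real_functions_def)
  note f = ereal_functionsD[OF f'(1)]
  define J where "J = (SUP t. inf (f (gt_ray t)) (f (lt_ray (t + e))))"
  have J: "inf (f (gt_ray t)) (f (lt_ray (t + e))) \<le> J" for t
    unfolding J_def by (rule sf_Sup_upper) auto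
  define d where "d = e / 2"
  have d: "d > 0" using assms(2) by (simp add: d_def)
  have step: "inf (f (gt_ray a)) (f (lt_ray (a + of_nat n * d))) \<le> J" for a n
  proof (induction n)
    case 0
    then show ?case using f(1)[of a a] by simp
  next
    case (Suc n)
    define c where "c = a + of_nat n * d"
    have "sup (f (gt_ray (c - d))) (f (lt_ray c)) = top" using d by (intro f(2)) simp
    then have "inf (f (gt_ray a)) (f (lt_ray (c + d))) =
      inf (sup (f (gt_ray (c - d))) (f (lt_ray c))) (inf (f (gt_ray a)) (f (lt_ray (c + d))))"
      by simp
    also have "\<dots> = sup (inf (f (gt_ray (c - d))) (inf (f (gt_ray a)) (f (lt_ray (c + d)))))
      (inf (f (lt_ray c)) (inf (f (gt_ray a)) (f (lt_ray (c + d)))))"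
      by (rule sf_inf_sup)
    also have "\<dots> \<le> J"
    proof (rule sup_least)
      have eq: "c + d = (c - d) + e" by (simp add: d_def)
      have "inf (f (gt_ray (c - d))) (f (lt_ray (c + d))) \<le> J"
        unfolding eq by (rule J)
      then show "inf (f (gt_ray (c - d))) (inf (f (gt_ray a)) (f (lt_ray (c + d)))) \<le> J"
        by (rule order_trans[rotated]) (simp add: le_infI2)
      show "inf (f (lt_ray c)) (inf (f (gt_ray a)) (f (lt_ray (c + d)))) \<le> J"
        using Suc.IH unfolding c_def[symmetric]
        by (rule order_trans[rotated]) (simp add: le_infI2)
    qed
    also have "c + d = a + of_nat (Suc n) * d" by (simp add: c_def algebra_simps)
    finally show ?case .
  qed
  have "inf (f (gt_ray a)) (f (lt_ray b)) \<le> J" for a b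
  proof -
    obtain n where "(b - a) / d \<le> of_nat n" using real_arch_simple by blast
    then have "b \<le> a + of_nat n * d" using d by (simp add: field_simps)
    then have "f (lt_ray b) \<le> f (lt_ray (a + of_nat n * d))" by (rule f(6))
    then show ?thesis using step[of a n] by (meson inf_mono order_refl order_trans)
  qed
  then have "inf (SUP p. f (gt_ray p)) (SUP q. f (lt_ray q)) \<le> J"
    by (intro sf_Sup_inf_Sup_le) auto
  then show ?thesis unfolding J_def[symmetric] using f' by (simp add: top_le)
qed

lemma add_fun_aux:
  assumes "f \<in> ereal_functions" "g \<in> ereal_functions"
  shows
    "inf (f (gt_ray t)) (g (gt_ray u)) \<le> (SUP s. inf (f (gt_ray s)) (g (gt_ray (t + u - s))))"
    "inf (f (lt_ray t)) (g (lt_ray u)) \<le> (SUP s. inf (f (lt_ray s)) (g (lt_ray (t + u - s))))"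
    "p \<le> p' \<Longrightarrow> (SUP s. inf (f (gt_ray s)) (g (gt_ray (p' - s)))) \<le>
       (SUP s. inf (f (gt_ray s)) (g (gt_ray (p - s))))"
    "q \<le> q' \<Longrightarrow> (SUP s. inf (f (lt_ray s)) (g (lt_ray (q - s)))) \<le>
       (SUP s. inf (f (lt_ray s)) (g (lt_ray (q' - s))))"
proof -
  note g = ereal_functionsD[OF assms(2)]
  show "inf (f (gt_ray t)) (g (gt_ray u)) \<le> (SUP s. inf (f (gt_ray s)) (g (gt_ray (t + u - s))))"
    "inf (f (lt_ray t)) (g (lt_ray u)) \<le> (SUP s. inf (f (lt_ray s)) (g (lt_ray (t + u - s))))"
    by (rule sf_Sup_upper; auto simp: image_iff intro!: exI[of _ t])+
  show "(SUP s. inf (f (gt_ray s)) (g (gt_ray (p' - s)))) \<le>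
       (SUP s. inf (f (gt_ray s)) (g (gt_ray (p - s))))" if "p \<le> p'"
  proof (rule sf_Sup_least)
    fix x assume "x \<in> range (\<lambda>s. inf (f (gt_ray s)) (g (gt_ray (p' - s))))"
    then obtain s where "x = inf (f (gt_ray s)) (g (gt_ray (p' - s)))" by blast
    moreover have "g (gt_ray (p' - s)) \<le> g (gt_ray (p - s))" using that by (intro g(5)) simp
    ultimately have "x \<le> inf (f (gt_ray s)) (g (gt_ray (p - s)))" by (simp add: le_infI2)
    then show "x \<le> (SUP s. inf (f (gt_ray s)) (g (gt_ray (p - s))))"
      by (rule sf_Sup_upper2[rotated 2]) auto
  qed simp
  show "(SUP s. inf (f (lt_ray s)) (g (lt_ray (q - s)))) \<le>
       (SUP s. inf (f (lt_ray s)) (g (lt_ray (q' - s))))" if "q \<le> q'"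
  proof (rule sf_Sup_least)
    fix x assume "x \<in> range (\<lambda>s. inf (f (lt_ray s)) (g (lt_ray (q - s))))"
    then obtain s where "x = inf (f (lt_ray s)) (g (lt_ray (q - s)))" by blast
    moreover have "g (lt_ray (q - s)) \<le> g (lt_ray (q' - s))" using that by (intro g(6)) simp
    ultimately have "x \<le> inf (f (lt_ray s)) (g (lt_ray (q' - s)))" by (simp add: le_infI2)
    then show "x \<le> (SUP s. inf (f (lt_ray s)) (g (lt_ray (q' - s))))"
      by (rule sf_Sup_upper2[rotated 2]) auto
  qed simp
qed

lemma add_fun_rels:
  assumes "f \<in> real_functions" "g \<in> real_functions"
  shows "satisfies_ereal_rels
    (\<lambda>p. SUP t. inf (f (gt_ray t)) (g (gt_ray (p - t))))
    (\<lambda>q. SUP t. inf (f (lt_ray t)) (g (lt_ray (q - t))))"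
    (is "satisfies_ereal_rels ?a ?b")
proof (rule satisfies_ereal_relsI)
  have f': "f \<in> ereal_functions" and g': "g \<in> ereal_functions"
    using assms by (auto simp: real_functions_def)
  note f = ereal_functionsD[OF f'] and g = ereal_functionsD[OF g'] and aux = add_fun_aux[OF f' g']
  show "inf (?a p) (?b q) = bot" if "q \<le> p" for p q
  proof -
    have "inf (inf (f (gt_ray t)) (g (gt_ray (p - t)))) (inf (f (lt_ray s)) (g (lt_ray (q - s)))) \<le> bot"
      for s t
    proof (cases "s \<le> t")
      case True
      show ?thesis
        unfolding f(1)[OF True, symmetric] by (simp add: le_infI1 le_infI2)
    next
      case False
      then have "q - s \<le> p - t" using that by simp
      then show ?thesis
        unfolding g(1)[OF \<open>q - s \<le> p - t\<close>, symmetric] by (simp add: le_infI1 le_infI2)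
    qed
    then have "inf (?a p) (?b q) \<le> bot" by (intro sf_Sup_inf_Sup_le) auto
    then show ?thesis by (simp add: bot_unique)
  qed
  show "sup (?a p) (?b q) = top" if "p < q" for p q
  proof -
    define e where "e = (q - p) / 2"
    have e: "e > 0" "p + e + e = q" using that by (simp_all add: e_def field_simps)
    have "inf (inf (f (gt_ray t)) (f (lt_ray (t + e)))) (inf (g (gt_ray s)) (g (lt_ray (s + e))))
      \<le> sup (?a p) (?b q)" (is "?x \<le> _") for s t
    proof (cases "p \<le> t + s")
      case True
      have "?x \<le> inf (f (gt_ray t)) (g (gt_ray s))" by (simp add: le_infI1 le_infI2)
      also have "\<dots> \<le> ?a (t + s)" by (rule aux(1))
      also have "\<dots> \<le> ?a p" by (rule aux(3)[OF True])
      finally show ?thesis by (simp add: le_supI1)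
    next
      case False
      have "?x \<le> inf (f (lt_ray (t + e))) (g (lt_ray (s + e)))" by (simp add: le_infI1 le_infI2)
      also have "\<dots> \<le> ?b (t + e + (s + e))" by (rule aux(2))
      also have "\<dots> \<le> ?b q" by (rule aux(4)) (use False e in simp)
      finally show ?thesis by (simp add: le_supI2)
    qed
    then have "inf (SUP t. inf (f (gt_ray t)) (f (lt_ray (t + e))))
      (SUP s. inf (g (gt_ray s)) (g (lt_ray (s + e)))) \<le> sup (?a p) (?b q)"
      by (intro sf_Sup_inf_Sup_le) auto
    then show ?thesis
      using real_functions_cover[OF assms(1) e(1)] real_functions_cover[OF assms(2) e(1)]
      by (simp add: top_le)
  qed
  show "?a p = Sup (?a ` {r. p < r})" for p
  proof (rule order.antisym)
    show "?a p \<le> Sup (?a ` {r. p < r})"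
    proof (rule sf_Sup_least)
      fix x assume "x \<in> range (\<lambda>t. inf (f (gt_ray t)) (g (gt_ray (p - t))))"
      then obtain t where x: "x = inf (f (gt_ray t)) (g (gt_ray (p - t)))" by blast
      have "inf (f (gt_ray t)) (g (gt_ray u)) \<le> Sup (?a ` {r. p < r})" if "p - t < u" for u
        by (rule sf_Sup_upper2[OF _ _ aux(1)]) (use that in auto)
      then show "x \<le> Sup (?a ` {r. p < r})"
        unfolding x by (subst g(3), subst sf_inf_Sup) (auto intro!: sf_Sup_least)
    qed simp
    show "Sup (?a ` {r. p < r}) \<le> ?a p"
      by (rule sf_Sup_least) (auto intro!: aux(3))
  qed
  show "?b q = Sup (?b ` {r. r < q})" for q
  proof (rule order.antisym)
    show "?b q \<le> Sup (?b ` {r. r < q})"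
    proof (rule sf_Sup_least)
      fix x assume "x \<in> range (\<lambda>t. inf (f (lt_ray t)) (g (lt_ray (q - t))))"
      then obtain t where x: "x = inf (f (lt_ray t)) (g (lt_ray (q - t)))" by blast
      have "inf (f (lt_ray t)) (g (lt_ray u)) \<le> Sup (?b ` {r. r < q})" if "u < q - t" for u
        by (rule sf_Sup_upper2[OF _ _ aux(2)]) (use that in auto)
      then show "x \<le> Sup (?b ` {r. r < q})"
        unfolding x by (subst g(4), subst sf_inf_Sup) (auto intro!: sf_Sup_least)
    qed simp
    show "Sup (?b ` {r. r < q}) \<le> ?b q"
      by (rule sf_Sup_least) (auto intro!: aux(4))
  qed
qed

lemma add_fun_real:
  assumes "f \<in> real_functions" "g \<in> real_functions"
  shows "add_fun f g \<in> real_functions"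
proof -
  have f: "f \<in> ereal_functions" "(SUP p. f (gt_ray p)) = top" "(SUP q. f (lt_ray q)) = top"
    and g: "g \<in> ereal_functions" "(SUP p. g (gt_ray p)) = top" "(SUP q. g (lt_ray q)) = top"
    using assms by (auto simp: real_functions_def)
  note aux = add_fun_aux[OF f(1) g(1)]
  let ?a = "\<lambda>p. SUP t. inf (f (gt_ray t)) (g (gt_ray (p - t)))"
  let ?b = "\<lambda>q. SUP t. inf (f (lt_ray t)) (g (lt_ray (q - t)))"
  have "inf (SUP p. f (gt_ray p)) (SUP p. g (gt_ray p)) \<le> (SUP p. ?a p)"
    by (rule sf_Sup_inf_Sup_le) (auto intro!: sf_Sup_upper2[OF _ _ aux(1)])
  moreover have "inf (SUP p. f (lt_ray p)) (SUP p. g (lt_ray p)) \<le> (SUP p. ?b p)"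
    by (rule sf_Sup_inf_Sup_le) (auto intro!: sf_Sup_upper2[OF _ _ aux(2)])
  ultimately show ?thesis
    unfolding add_fun_def
    by (intro ereal_hom_real add_fun_rels assms) (simp_all add: f g top_le)
qed

lemma sum_fun_real:
  assumes "\<And>i. 1 \<le> i \<Longrightarrow> h i \<in> real_functions"
  shows "sum_fun h k \<in> real_functions"
  by (induction k) (simp_all add: zero_fun_real add_fun_real assms)

end

theory Submission
  imports Defs "HOL-Analysis.Harmonic_Numbers"
begin

text \<open>
  Pointwise, \<open>f\<close> is expanded greedily: \<open>1/k\<close> is added to the partial sum \<open>s\<close> exactly where
  \<open>f > s + 1/k\<close>. The partial sums increase and stay below \<open>f\<close>. They converge to \<open>f\<close>: where the
  partial sums are bounded, divergence of the harmonic series forces infinitely many terms to be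
  skipped, and each skipped term \<open>1/k\<close> bounds the remaining error. Without points, the
  first \<open>k\<close> choices are recorded by a word of length \<open>k\<close>; the words index a finite partition into
  complemented elements, on each of which the partial sum is constant.
\<close>

section \<open>Complements of the congruences \<open>nabla a\<close>\<close>

text \<open>This is the open congruence of \<open>a\<close>, generated by the pair
  \<open>(a, top)\<close>.\<close>

lift_definition delta :: "'a::sigma_frame \<Rightarrow> 'a congruence" is
  "\<lambda>a. {(x, y). inf x a = inf y a}"
proof (rule is_congruenceI)
  fix a :: 'a and A assume A: "countable A" "A \<subseteq> {(x, y). inf x a = inf y a}"
  have "(\<lambda>z. inf (fst z) a) ` A = (\<lambda>z. inf (snd z) a) ` A"
    using A(2) by (intro image_cong) auto
  then show "(Sup (fst ` A), Sup (snd ` A)) \<in> {(x, y). inf x a = inf y a}"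
    using A(1) by (simp add: sf_Sup_inf image_image)
next
  fix a x y x' y' :: 'a
  assume "(x, y) \<in> {(x, y). inf x a = inf y a}" "(x', y') \<in> {(x, y). inf x a = inf y a}"
  then have "inf (inf x a) (inf x' a) = inf (inf y a) (inf y' a)" by simp
  then show "(inf x x', inf y y') \<in> {(x, y). inf x a = inf y a}"
    by (simp add: inf.assoc inf.left_commute inf.commute)
qed auto

text \<open>In a distributive lattice \<open>x\<close> is determined by \<open>sup x a\<close> and
  \<open>inf x a\<close>, so the meet is trivial. The join relates \<open>bot\<close> to
  \<open>a\<close> and \<open>a\<close> to \<open>top\<close>, hence everything.\<close>

lemma is_complement_nabla_delta: "is_complement (nabla a) (delta a)"
  unfolding is_complement_def
proof
  have "pairs (inf (nabla a) (delta a)) \<subseteq> pairs bot"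
  proof clarify
    fix x y assume "(x, y) \<in> pairs (inf (nabla a) (delta a))"
    then have eq: "sup x a = sup y a" "inf x a = inf y a"
      by (simp_all add: inf_congruence.rep_eq nabla.rep_eq delta.rep_eq)
    have "x = inf x (sup x a)" by (simp add: inf_sup_absorb)
    also have "\<dots> = sup (inf x y) (inf x a)" by (simp add: eq(1) inf_sup_distrib1)
    also have "\<dots> = inf y (sup y a)"
      by (metis eq inf_sup_distrib1 inf.commute)
    also have "\<dots> = y" by (simp add: inf_sup_absorb)
    finally show "(x, y) \<in> pairs bot"
      by (simp add: is_congruenceD(1)[OF is_congruence_pairs])
  qed
  then show "inf (nabla a) (delta a) = bot"
    by (simp add: bot_unique flip: less_eq_congruence.rep_eq)
  let ?t = "sup (nabla a) (delta a)"
  note t = is_congruenceD[OF is_congruence_pairs[of ?t]]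
  have "pairs (nabla a) \<subseteq> pairs ?t" "pairs (delta a) \<subseteq> pairs ?t"
    by (simp_all flip: less_eq_congruence.rep_eq)
  moreover have "(bot, a) \<in> pairs (nabla a)" "(a, top) \<in> pairs (delta a)"
    by (simp_all add: nabla.rep_eq delta.rep_eq)
  ultimately have bt: "(bot, top) \<in> pairs ?t" using t(3) by blast
  have b: "(bot, x) \<in> pairs ?t" for x
    using t(4)[OF t(1)[of x] bt] by simp
  have "pairs top \<subseteq> pairs ?t"
    using t(3)[OF t(2)[OF b] b] by auto
  then show "?t = top"
    by (simp add: top_unique flip: less_eq_congruence.rep_eq)
qed

section \<open>Joins of countable families\<close>

lemma sf_SUP_upper2: "y \<le> g i \<Longrightarrow> i \<in> I \<Longrightarrow> countable I \<Longrightarrow> y \<le> (SUP i\<in>I. g i :: 'n::sigma_frame)"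
  by (rule sf_Sup_upper2[of _ "g i"]) auto

lemma sf_SUP_least: "(\<And>i. i \<in> I \<Longrightarrow> g i \<le> z) \<Longrightarrow> countable I \<Longrightarrow> (SUP i\<in>I. g i :: 'n::sigma_frame) \<le> z"
  by (rule sf_Sup_least) auto

lemma sf_inf_SUP_le:
  fixes g :: "'i \<Rightarrow> 'n::sigma_frame"
  shows "(\<And>i. i \<in> I \<Longrightarrow> inf x (g i) \<le> z) \<Longrightarrow> countable I \<Longrightarrow> inf x (SUP i\<in>I. g i) \<le> z"
  by (simp add: sf_inf_Sup image_image sf_SUP_least)

section \<open>Words, cells and greedy sets\<close>

text \<open>Words are read from right to left: the last choice made is the head of the list.\<close>

primrec word_value :: "bool list \<Rightarrow> rat" where
  "word_value [] = 0"
| "word_value (b # w) = word_value w + (if b then 1 / of_nat (Suc (length w)) else 0)"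

text \<open>With \<open>F p\<close> read as the region where \<open>f > p\<close>, the cell of a word is the region where the
  greedy expansion makes the choices recorded by the word.\<close>

primrec cell :: "(rat \<Rightarrow> 'n::sigma_frame) \<Rightarrow> bool list \<Rightarrow> 'n" where
  "cell F [] = top"
| "cell F (b # w) = inf (cell F w)
     (if b then F (word_value (True # w)) else the_complement (F (word_value (True # w))))"

text \<open>The region where the expansion takes the term 1/k; terms are counted from 1.\<close>

definition greedy_set :: "(rat \<Rightarrow> 'n::sigma_frame) \<Rightarrow> nat \<Rightarrow> 'n" where
  "greedy_set F k = (SUP w\<in>{w. Suc (length w) = k}. cell F (True # w))"

declare word_value.simps(2) [simp del] cell.simps(2) [simp del]

lemma word_value_Cons:
  "word_value (True # w) = word_value w + 1 / of_nat (Suc (length w))"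
  "word_value (False # w) = word_value w"
  by (simp_all add: word_value.simps(2))

lemma cell_Cons:
  "cell F (True # w) = inf (cell F w) (F (word_value (True # w)))"
  "cell F (False # w) = inf (cell F w) (the_complement (F (word_value (True # w))))"
  by (simp_all add: cell.simps(2))

lemma cell_Cons_le: "cell F (b # w) \<le> cell F w"
  by (simp add: cell.simps(2))

section \<open>Cells as a finite partition\<close>

context
  fixes F :: "rat \<Rightarrow> 'n::sigma_frame"
  assumes F: "\<And>p. is_complemented (F p)"
begin

lemma cell_split: "cell F w = sup (cell F (True # w)) (cell F (False # w))"
  using the_complement_works[OF F]
  by (simp add: cell_Cons is_complement_def flip: inf_sup_distrib1)

text \<open>Two such words part ways just after a common tail; there one cell lies below some
  \<open>F v\<close> and the other below its complement.\<close>

lemma cell_disjoint: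
  "length w = length w' \<Longrightarrow> w \<noteq> w' \<Longrightarrow> inf (cell F w) (cell F w') = bot"
proof (induction w w' rule: list_induct2)
  case (Cons b w b' w')
  show ?case
  proof (cases "w = w'")
    case False
    then have "inf (cell F w) (cell F w') = bot" using Cons by simp
    then show ?thesis
      using inf_mono[OF cell_Cons_le[of F b w] cell_Cons_le[of F b' w']] by (simp add: bot_unique)
  next
    case True
    let ?a = "F (word_value (True # w))"
    have "inf ?a (the_complement ?a) = bot"
      using the_complement_works[OF F] by (simp add: is_complement_def)
    moreover have "inf (cell F (b # w)) (cell F (b' # w')) \<le> inf ?a (the_complement ?a)"
      using True Cons by (cases b; cases b') (simp_all add: cell_Cons le_infI1 le_infI2)
    ultimately show ?thesis by (simp add: bot_unique)
  qed
qed simp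

text \<open>The trivial \<open>P\<close> yields the partition; \<open>P w\<close> as
  \<open>p < word_value w\<close> yields the level sets of the partial sums.\<close>

lemma SUP_cell_Suc:
  "(SUP w\<in>{w. length w = Suc k \<and> P w}. cell F w) =
     sup (SUP w\<in>{w. length w = k \<and> P (True # w)}. cell F (True # w))
         (SUP w\<in>{w. length w = k \<and> P (False # w)}. cell F (False # w))" (is "?l = sup ?t ?f")
proof (rule order.antisym)
  show "?l \<le> sup ?t ?f"
  proof (rule sf_SUP_least)
    fix w assume w: "w \<in> {w. length w = Suc k \<and> P w}"
    then obtain b v where v: "w = b # v" by (cases w) auto
    show "cell F w \<le> sup ?t ?f"
    proof (cases b)
      case True
      then have "cell F w \<le> ?t" using w v by (intro sf_SUP_upper2[where i = v]) auto
      then show ?thesis by (rule le_supI1)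
    next
      case False
      then have "cell F w \<le> ?f" using w v by (intro sf_SUP_upper2[where i = v]) auto
      then show ?thesis by (rule le_supI2)
    qed
  qed simp
  show "sup ?t ?f \<le> ?l"
    by (intro sup_least sf_SUP_least) (auto intro!: sf_SUP_upper2)
qed

lemma SUP_cell_top: "(SUP w\<in>{w. length w = k}. cell F w) = top"
proof (induction k)
  case (Suc k)
  have "(SUP w\<in>{w. length w = k}. cell F w) \<le>
      sup (SUP w\<in>{w. length w = k}. cell F (True # w)) (SUP w\<in>{w. length w = k}. cell F (False # w))"
    by (rule sf_SUP_least, subst cell_split, intro sup_mono sf_SUP_upper2) auto
  then show ?case using SUP_cell_Suc[where P = "\<lambda>_. True"] Suc by (simp add: top_unique)
qed (simp add: sf_Sup_topI)

lemma is_complemented_greedy_set: "is_complemented (greedy_set F (Suc k))"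
proof -
  \<comment> \<open>The complement is the region where the term is skipped.\<close>
  let ?c = "SUP w\<in>{w. length w = k}. cell F (False # w)"
  have "sup (greedy_set F (Suc k)) ?c = top"
    using SUP_cell_Suc[where P = "\<lambda>_. True"] SUP_cell_top[of "Suc k"] by (simp add: greedy_set_def)
  moreover have "inf (greedy_set F (Suc k)) ?c \<le> bot"
    unfolding greedy_set_def
    by (rule sf_Sup_inf_Sup_le) (auto simp: cell_disjoint)
  ultimately show ?thesis
    unfolding is_complemented_def is_complement_def by (blast intro: bot_unique[THEN iffD1])
qed

text \<open>By disjointness only the joinand of \<open>w\<close> itself survives. This lets the new
  summand be evaluated cell by cell.\<close>

lemma inf_greedy_set_cell:
  assumes "length w = k"
  shows "inf (greedy_set F (Suc k)) (cell F w) = cell F (True # w)"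
proof (rule order.antisym)
  have "inf (cell F w) (cell F (True # v)) \<le> cell F (True # w)" if "length v = k" for v
  proof (cases "v = w")
    case False
    have "inf (cell F w) (cell F (True # v)) \<le> inf (cell F w) (cell F v)"
      by (intro inf_mono cell_Cons_le order_refl)
    then show ?thesis using cell_disjoint[of w v] that assms False by (simp add: bot_unique)
  qed simp
  then show "inf (greedy_set F (Suc k)) (cell F w) \<le> cell F (True # w)"
    unfolding greedy_set_def by (subst inf.commute, intro sf_inf_SUP_le) auto
  show "cell F (True # w) \<le> inf (greedy_set F (Suc k)) (cell F w)"
    unfolding greedy_set_def
    by (rule inf_greatest[OF sf_SUP_upper2 cell_Cons_le]) (use assms in auto)
qed

section \<open>Level sets of the partial sums\<close>

abbreviation greedy_sum :: "nat \<Rightarrow> ereal_frame \<Rightarrow> 'n" where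
  "greedy_sum \<equiv> sum_fun (\<lambda>i. scale_fun (1 / of_nat i) (chi_fun (greedy_set F i)))"

lemma greedy_term_real:
  "scale_fun (1 / of_nat (Suc k)) (chi_fun (greedy_set F (Suc k))) \<in> real_functions"
  by (intro scale_fun_real chi_fun_real is_complemented_greedy_set) simp

lemma greedy_sum_real: "greedy_sum k \<in> real_functions"
proof (rule sum_fun_real)
  fix i :: nat assume "1 \<le> i"
  then show "scale_fun (1 / of_nat i) (chi_fun (greedy_set F i)) \<in> real_functions"
    using greedy_term_real[of "i - 1"] by simp
qed

lemma greedy_term_gt_ray:
  "scale_fun (1 / of_nat (Suc k)) (chi_fun (greedy_set F (Suc k))) (gt_ray p) =
     (if p < 0 then top else if p < 1 / of_nat (Suc k) then greedy_set F (Suc k) else bot)"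
proof -
  have "chi_fun (greedy_set F (Suc k)) \<in> ereal_functions"
    using chi_fun_real[OF is_complemented_greedy_set] by (auto simp: real_functions_def)
  then have "scale_fun (1 / of_nat (Suc k)) (chi_fun (greedy_set F (Suc k))) (gt_ray p) =
      chi_fun (greedy_set F (Suc k)) (gt_ray (p * of_nat (Suc k)))"
    unfolding scale_fun_def by (subst ereal_hom_universal(2)[OF scale_fun_rels]) auto
  also have "\<dots> = (if p * of_nat (Suc k) < 0 then top
      else if p * of_nat (Suc k) < 1 then greedy_set F (Suc k) else bot)"
    unfolding chi_fun_def
    by (rule ereal_hom_universal(2)[OF chi_fun_rels[OF
          the_complement_works[OF is_complemented_greedy_set]]])
  also have "p * of_nat (Suc k) < 0 \<longleftrightarrow> p < 0"
    by (auto simp: mult_less_0_iff)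
  also have "p * of_nat (Suc k) < 1 \<longleftrightarrow> p < 1 / of_nat (Suc k)"
    by (simp add: field_simps)
  finally show ?thesis .
qed

lemma greedy_sum_Suc_gt_ray:
  "greedy_sum (Suc k) (gt_ray p) = (SUP t. inf (greedy_sum k (gt_ray t))
     (scale_fun (1 / of_nat (Suc k)) (chi_fun (greedy_set F (Suc k))) (gt_ray (p - t))))"
  unfolding sum_fun.simps add_fun_def
  by (rule ereal_hom_universal(2)[OF add_fun_rels[OF greedy_sum_real greedy_term_real]])

lemma greedy_sum_mono: "k \<le> l \<Longrightarrow> greedy_sum k (gt_ray p) \<le> greedy_sum l (gt_ray p)"
proof (induction l rule: dec_induct)
  case (step l)
  have "greedy_sum l \<in> ereal_functions"
    using greedy_sum_real by (simp add: real_functions_def)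
  \<comment> \<open>Passing to \<open>t > p\<close> leaves the new term a negative threshold
    \<open>p - t\<close>, where it is \<open>top\<close>; at \<open>t = p\<close> it need not
    be.\<close>
  then have "greedy_sum l (gt_ray p) = (SUP t\<in>{t. p < t}. greedy_sum l (gt_ray t))"
    by (rule ereal_functionsD(3))
  also have "\<dots> \<le> greedy_sum (Suc l) (gt_ray p)"
  proof (rule sf_SUP_least)
    fix t assume "t \<in> {t. p < t}"
    then show "greedy_sum l (gt_ray t) \<le> greedy_sum (Suc l) (gt_ray p)"
      unfolding greedy_sum_Suc_gt_ray
      by (intro sf_SUP_upper2[where i = t]) (auto simp: greedy_term_gt_ray simp del: of_nat_Suc)
  qed simp
  finally show ?case using step.IH by simp
qed simp

text \<open>The point-free form of the fact that the partial sum has the constant value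
  \<open>word_value w\<close> on the cell of \<open>w\<close>.\<close>

lemma greedy_sum_gt_ray:
  "greedy_sum k (gt_ray p) = (SUP w\<in>{w. length w = k \<and> p < word_value w}. cell F w)"
proof (induction k arbitrary: p)
  case 0
  have "{w. w = [] \<and> p < word_value w} = (if p < 0 then {[]} else {})" by auto
  then show ?case
    by (simp add: zero_fun_def ereal_hom_universal(2)[OF zero_fun_rels] sf_Sup_topI)
next
  case (Suc k)
  let ?e = "1 / of_nat (Suc k) :: rat" and ?\<theta> = "greedy_set F (Suc k)"
  let ?S = "\<lambda>k p. SUP w\<in>{w. length w = k \<and> p < word_value w}. cell F w"
  have upper: "cell F w \<le> ?S k p" if "length w = k" "p < word_value w" for k p w
    using that by (intro sf_SUP_upper2[where i = w]) auto
  \<comment> \<open>Both extensions of \<open>w\<close> have at least its value.\<close>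
  have le_S: "cell F w \<le> ?S (Suc k) p" if w: "length w = k" "p < word_value w" for w
    by (subst cell_split, intro sup_least upper; use w in \<open>simp add: word_value_Cons less_le_trans[OF w(2)]\<close>)
  show ?case
  proof (rule order.antisym)
    show "greedy_sum (Suc k) (gt_ray p) \<le> ?S (Suc k) p"
      unfolding greedy_sum_Suc_gt_ray Suc
    proof (rule sf_SUP_least)
      fix t
      \<comment> \<open>In these ranges the ray of the new term is \<open>top\<close>, the greedy
        set and \<open>bot\<close>, respectively.\<close>
      consider "p - t < 0" | "0 \<le> p - t" "p - t < ?e" | "?e \<le> p - t" "0 \<le> p - t"
        by linarith
      then show "inf (?S k t) (scale_fun ?e (chi_fun ?\<theta>) (gt_ray (p - t))) \<le> ?S (Suc k) p"
      proof cases
        case 1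
        then have "?S k t \<le> ?S (Suc k) p" by (intro sf_SUP_least le_S) auto
        then show ?thesis by (rule le_infI1)
      next
        case 2
        then have "inf ?\<theta> (?S k t) \<le> ?S (Suc k) p"
          by (intro sf_inf_SUP_le) (auto simp: inf_greedy_set_cell word_value_Cons intro!: upper)
        with 2 show ?thesis by (subst greedy_term_gt_ray) (simp add: inf.commute)
      next
        case 3
        then show ?thesis by (subst greedy_term_gt_ray) simp
      qed
    qed simp
    have le_sum: "cell F w \<le> greedy_sum (Suc k) (gt_ray p)" if "length w = k" "p < word_value w" for w
    proof -
      have "cell F w \<le> greedy_sum k (gt_ray p)" unfolding Suc by (rule upper[OF that])
      also have "\<dots> \<le> greedy_sum (Suc k) (gt_ray p)" by (rule greedy_sum_mono) simp
      finally show ?thesis .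
    qed
    show "?S (Suc k) p \<le> greedy_sum (Suc k) (gt_ray p)"
      unfolding SUP_cell_Suc
    proof (intro sup_least sf_SUP_least)
      fix w assume "w \<in> {w. length w = k \<and> p < word_value (False # w)}"
      then show "cell F (False # w) \<le> greedy_sum (Suc k) (gt_ray p)"
        by (intro order_trans[OF cell_Cons_le le_sum]) (auto simp: word_value_Cons)
    next
      fix w assume "w \<in> {w. length w = k \<and> p < word_value (True # w)}"
      then have w: "length w = k" "p < word_value w + ?e" by (auto simp: word_value_Cons)
      show "cell F (True # w) \<le> greedy_sum (Suc k) (gt_ray p)"
      proof (cases "p < word_value w")
        case True
        then show ?thesis using w(1) by (intro order_trans[OF cell_Cons_le le_sum])
      next
        case False
        \<comment> \<open>As \<open>word_value w \<le> p\<close>, this gives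
          \<open>0 < p - t < ?e\<close>: the old sum exceeds \<open>t\<close> on the cell, and the
          ray of the new term at \<open>p - t\<close> is \<open>?\<theta>\<close>.\<close>
        obtain t where t: "p - ?e < t" "t < word_value w"
          using dense[of "p - ?e" "word_value w"] w(2) by auto
        have "cell F (True # w) = inf (cell F w) ?\<theta>"
          using inf_greedy_set_cell[OF w(1)] by (simp add: inf.commute)
        also have "\<dots> \<le> inf (?S k t) (scale_fun ?e (chi_fun ?\<theta>) (gt_ray (p - t)))"
          using t False w(1) by (intro inf_mono upper) (auto simp: greedy_term_gt_ray simp del: of_nat_Suc)
        also have "\<dots> \<le> greedy_sum (Suc k) (gt_ray p)"
          unfolding greedy_sum_Suc_gt_ray Suc by (rule sf_SUP_upper2[where i = t]) auto
        finally show ?thesis .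
      qed
    qed auto
  qed
qed

section \<open>Upper bound and convergence\<close>

text \<open>A skipped term leaves the value unchanged, and a taken one puts the cell below
  \<open>F\<close> at the new value. The empty word has value 0, which is where the first assumption
  enters.\<close>

lemma greedy_sum_le:
  assumes "\<And>p. p < 0 \<Longrightarrow> F p = top" "antimono F"
  shows "greedy_sum k (gt_ray p) \<le> F p"
proof -
  have "cell F w \<le> F p" if "p < word_value w" for w
    using that
  proof (induction w)
    case Nil
    then show ?case by (simp add: assms(1))
  next
    case (Cons b w)
    show ?case
    proof (cases b)
      case True
      then have "cell F (b # w) \<le> F (word_value (b # w))" by (simp add: cell_Cons)
      also have "\<dots> \<le> F p" using Cons.prems by (intro antimonoD[OF assms(2)]) simp
      finally show ?thesis .
    next
      case False
      then show ?thesis using Cons cell_Cons_le[of F b w] by (auto simp: word_value_Cons)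
    qed
  qed
  then show ?thesis unfolding greedy_sum_gt_ray by (intro sf_SUP_least) auto
qed

text \<open>If \<open>f > r > p\<close> and \<open>1/(k + 1) \<le> r - p\<close>, then skipping \<open>1/(k + 1)\<close> means that the partial
  sum already exceeds \<open>p\<close>; if nothing is skipped, it eventually exceeds \<open>p\<close> by divergence.\<close>

lemma inf_cell_le_greedy_sums:
  assumes "antimono F" "p < r"
    and "length w \<le> n" "1 / of_nat (Suc (length w)) \<le> r - p"
    and "real_of_rat (p - word_value w) < harm n - harm (length w)"
  shows "inf (F r) (cell F w) \<le> (SUP k. greedy_sum k (gt_ray p))" (is "_ \<le> ?Z")
proof -
  have exceeded: "cell F w \<le> ?Z" if "p < word_value w" for w
  proof -
    have "cell F w \<le> greedy_sum (length w) (gt_ray p)"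
      unfolding greedy_sum_gt_ray using that by (intro sf_SUP_upper2[where i = w]) auto
    also have "\<dots> \<le> ?Z" by (rule sf_SUP_upper2) auto
    finally show ?thesis .
  qed
  \<comment> \<open>Descending induction from \<open>n\<close>. The last condition says that taking
    all terms from 1/(k + 1) to 1/n would lift the sum above \<open>p\<close>; it persists when a
    term is taken and gives \<open>p < word_value w\<close> at \<open>k = n\<close>.\<close>
  have "inf (F r) (cell F w) \<le> ?Z"
    if "k \<le> n" "length w = k" "1 / of_nat (Suc k) \<le> r - p"
      "real_of_rat (p - word_value w) < harm n - harm k" for k w
    using that
  proof (induction k arbitrary: w rule: inc_induct)
    case base
    then have "real_of_rat (p - word_value w) < 0" by simp
    then have "p < word_value w" by simp
    then show ?case using exceeded le_infI2 by blast
  next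
    case (step k)
    let ?v = "word_value (True # w)"
    have v: "?v = word_value w + 1 / of_nat (Suc k)"
      using step.prems(1) by (simp add: word_value_Cons)
    have "1 / rat_of_nat (Suc (Suc k)) \<le> 1 / of_nat (Suc k)"
      by (simp add: frac_le)
    then have "1 / rat_of_nat (Suc (Suc k)) \<le> r - p"
      using step.prems(2) by linarith
    moreover have "real_of_rat (p - ?v) < harm n - harm (Suc k)"
      using step.prems(3)
      by (simp add: v harm_Suc of_rat_diff of_rat_add of_rat_divide inverse_eq_divide del: of_nat_Suc)
    ultimately have taken: "inf (F r) (cell F (True # w)) \<le> ?Z"
      using step.prems(1) by (intro step.IH) auto
    have skipped: "inf (F r) (cell F (False # w)) \<le> ?Z"
    \<comment> \<open>If \<open>?v \<le> r\<close>, then \<open>F r\<close> lies below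
      \<open>F ?v\<close>, disjoint from the skipping cell. Otherwise
      \<open>word_value w > r - 1/(k + 1) \<ge> p\<close>.\<close>
    proof (cases "?v \<le> r")
      case True
      have "inf (F r) (cell F (False # w)) \<le> inf (F ?v) (the_complement (F ?v))"
        unfolding cell_Cons using antimonoD[OF assms(1) True] by (simp add: le_infI1 le_infI2)
      also have "\<dots> = bot"
        using the_complement_works[OF F] by (simp add: is_complement_def)
      finally show ?thesis by (simp add: bot_unique)
    next
      case False
      then have "p < word_value (False # w)"
        using step.prems(2) v by (simp add: word_value_Cons del: of_nat_Suc)
      then show ?thesis using exceeded le_infI2 by blast
    qed
    show ?case
      unfolding cell_split[of w] inf_sup_distrib1 using taken skipped by simp
  qed
  then show ?thesis using assms(3-5) by blast
qed

text \<open>The gap \<open>r - p\<close> fixes a length \<open>k\<close> beyond which skipping is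
  harmless. The cells of length \<open>k\<close> cover \<open>top\<close>, and each gets its own
  \<open>n\<close> from the divergence of the harmonic series.\<close>

lemma le_SUP_greedy_sum:
  assumes "antimono F" "p < r"
  shows "F r \<le> (SUP k. greedy_sum k (gt_ray p))"
proof -
  obtain k where "1 / (r - p) \<le> of_nat k" using real_arch_simple by blast
  then have k: "1 / of_nat (Suc k) \<le> r - p"
    using assms(2) by (simp add: field_simps add_increasing2)
  have "inf (F r) (cell F w) \<le> (SUP k. greedy_sum k (gt_ray p))" if w: "length w = k" for w
  proof -
    have "eventually (\<lambda>n. real_of_rat (p - word_value w) + harm k < harm n \<and> k \<le> n) sequentially"
      using harm_at_top by (intro eventually_conj eventually_ge_at_top) (auto simp: filterlim_at_top_dense)
    then obtain n where "real_of_rat (p - word_value w) + harm k < harm n" "k \<le> n"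
      using eventually_happens by fastforce
    then show ?thesis
      using assms k w by (intro inf_cell_le_greedy_sums[of p r w n]) auto
  qed
  then have "inf (F r) (SUP w\<in>{w. length w = k}. cell F w) \<le> (SUP k. greedy_sum k (gt_ray p))"
    by (intro sf_inf_SUP_le) auto
  then show ?thesis by (simp add: SUP_cell_top)
qed

end

section \<open>Limits of increasing sequences and conclusion\<close>

text \<open>The infimum of each tail is its first member, and the supremum of each tail is
  \<open>f\<close>, since tails are cofinal.\<close>

lemma is_lim_fun_incseq:
  assumes s: "\<And>k. s k \<in> ereal_functions" and f: "f \<in> ereal_functions"
    and mono: "\<And>k l p. k \<le> l \<Longrightarrow> s k (gt_ray p) \<le> s l (gt_ray p)"
    and lim: "\<And>p. f (gt_ray p) = (SUP k. s k (gt_ray p))"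
  shows "is_lim_fun s f"
proof -
  have le: "ereal_fun_le (s k) f" for k
    unfolding ereal_fun_le_def lim by (auto intro: sf_SUP_upper2)
  have least: "ereal_fun_le f u" if "\<And>k. n \<le> k \<Longrightarrow> ereal_fun_le (s k) u" for u n
    unfolding ereal_fun_le_def lim
  proof (intro allI sf_SUP_least)
    fix p k
    \<comment> \<open>The index \<open>max n k\<close> moves \<open>k\<close> into the tail.\<close>
    have "s k (gt_ray p) \<le> s (max n k) (gt_ray p)" by (rule mono) simp
    also have "\<dots> \<le> u (gt_ray p)" using that[of "max n k"] by (simp add: ereal_fun_le_def)
    finally show "s k (gt_ray p) \<le> u (gt_ray p)" .
  qed simp
  have refl: "ereal_fun_le g g" for g :: "ereal_frame \<Rightarrow> 'a" by (simp add: ereal_fun_le_def)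
  have "is_inf_fun (s ` {n..}) (s n)" for n
    using s mono by (auto simp: is_inf_fun_def ereal_fun_le_def)
  moreover have "is_sup_fun (s ` {n..}) f" for n
    using f le least by (auto simp: is_sup_fun_def)
  moreover have "is_inf_fun ((\<lambda>_. f) ` {1::nat..}) f"
    using f refl by (auto simp: is_inf_fun_def)
  ultimately show ?thesis
    unfolding is_lim_fun_def is_liminf_fun_def is_limsup_fun_def
    using s by (intro conjI exI[of _ s] exI[of _ "\<lambda>_. f"]) auto
qed

text \<open>Here measurability is replaced by complemented upper rays in an arbitrary sigma-frame;
  \<open>is_complement_nabla_delta\<close> supplies these for congruences.\<close>

theorem is_lim_fun_greedy_sum:
  fixes f :: "ereal_frame \<Rightarrow> 'n::sigma_frame"
  assumes f: "f \<in> ereal_functions" "nonneg_fun f" and compl: "\<And>p. is_complemented (f (gt_ray p))"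
  shows "is_lim_fun
    (sum_fun (\<lambda>i. scale_fun (1 / of_nat i) (chi_fun (greedy_set (\<lambda>p. f (gt_ray p)) i)))) f"
    (is "is_lim_fun ?s f")
proof (rule is_lim_fun_incseq)
  show "?s k \<in> ereal_functions" for k
    using greedy_sum_real[OF compl] by (simp add: real_functions_def)
  show "?s k (gt_ray p) \<le> ?s l (gt_ray p)" if "k \<le> l" for k l p
    by (rule greedy_sum_mono[OF compl that])
  have anti: "antimono (\<lambda>p. f (gt_ray p))"
    by (intro antimonoI ereal_functionsD(5)[OF f(1)])
  have "zero_fun (gt_ray p) \<le> f (gt_ray p)" for p
    using f(2) by (simp add: nonneg_fun_def ereal_fun_le_def)
  then have top: "f (gt_ray p) = top" if "p < 0" for p
    using that by (metis zero_fun_def ereal_hom_universal(2)[OF zero_fun_rels] top_unique)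
  show "f (gt_ray p) = (SUP k. ?s k (gt_ray p))" for p
  proof (rule order.antisym)
    show "f (gt_ray p) \<le> (SUP k. ?s k (gt_ray p))"
      \<comment> \<open>Writing the ray at \<open>p\<close> as the join of the rays at
        \<open>r > p\<close> supplies the strict gap that \<open>le_SUP_greedy_sum\<close> asks
        for.\<close>
      by (subst ereal_functionsD(3)[OF f(1)], rule sf_SUP_least)
        (simp_all add: le_SUP_greedy_sum[OF compl anti])
    show "(SUP k. ?s k (gt_ray p)) \<le> f (gt_ray p)"
      by (rule sf_SUP_least) (simp_all add: greedy_sum_le[OF compl top anti])
  qed
qed (rule f)

theorem corollary6p3:
  fixes f :: "ereal_frame \<Rightarrow> 'a::sigma_frame congruence"
  assumes "f \<in> ereal_functions" and "nonneg_fun f" and "measurable_fun f"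
  shows "\<exists>\<theta> :: nat \<Rightarrow> 'a congruence.
           (\<forall>i\<ge>1. is_complemented (\<theta> i)) \<and>
           is_lim_fun (\<lambda>k. sum_fun (\<lambda>i. scale_fun (1 / of_nat i) (chi_fun (\<theta> i))) k) f"
proof (intro exI[of _ "greedy_set (\<lambda>p. f (gt_ray p))"] conjI allI impI)
  have compl: "is_complemented (f (gt_ray p))" for p
  proof -
    obtain a where "f (gt_ray p) = nabla a" using assms(3) by (auto simp: measurable_fun_def)
    then show ?thesis using is_complement_nabla_delta by (auto simp: is_complemented_def)
  qed
  show "is_complemented (greedy_set (\<lambda>p. f (gt_ray p)) i)" if "1 \<le> i" for i
    using is_complemented_greedy_set[of "\<lambda>p. f (gt_ray p)", OF compl, of "i - 1"] that by simp
  show "is_lim_fun (\<lambda>k. sum_fun (\<lambda>i. scale_fun (1 / of_nat i)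
      (chi_fun (greedy_set (\<lambda>p. f (gt_ray p)) i))) k) f"
    using is_lim_fun_greedy_sum[OF assms(1,2) compl] .
qed

end
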